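(* Let $G$ be a finite group. Then $G$ is a maximal graph group if and only if $|G|\ge 6$ and $G$ is a quotient of the modular group $\Gamma=\langle x,y \mid x^2=y^3=1\rangle$ (equivalently, $|G|\ge 6$ and $G$ is generated by an element of order $2$ together with an element of order $3$).
   Context: A graph is a finite multigraph without loop edges (two vertices may be joined by several edges, but no edge joins a vertex to itself). For a vertex $x$ of a graph $X$, $x(1)$ denotes the subgraph consisting of $x$, its neighbours, and the edges incident to $x$. The genus of a connected graph $X$ is $g(X)=|E(X)|-|V(X)|+1$. A morphism of graphs $\phi:Y\to X$ is a map $V(Y)\cup E(Y)\to V(X)\cup E(X)$ sending vertices to vertices such that for each edge $e$ of $Y$ with endpoints $y_1\neq y_2$, either $\phi(e)$ is an edge with endpoints $\phi(y_1)\neq\phi(y_2)$, or $\phi(e)=\phi(y_1)=\phi(y_2)$ is a vertex (then $e$ is called $\phi$-vertical). $\phi$ is harmonic if for every vertex $y$ of $Y$ the number $|\phi^{-1}(e')\cap E(y(1))|$ is the same for all edges $e'$ incident to $\phi(y)$. If $G\le \mathrm{Aut}(Y)$ acts on $Y$ such that the stabilizer of each connected component acts faithfully on it (a faithful action), the quotient graph $G\backslash Y$ has as vertices the $G$-orbits of vertices and as edges the $G$-orbits of those edges whose endpoints lie in different $G$-orbits; the quotient morphism $\phi_G:Y\to G\backslash Y$ sends vertices and edges to their orbits, edges whose endpoints lie in the same orbit being $\phi_G$-vertical. The action $(G,Y)$ is harmonic if for every subgroup $H\le G$ the quotient morphism $\phi_H:Y\to H\backslash Y$ is harmonic. (Equivalently,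 for every vertex $y$ the stabilizer of $y$ acts freely on the set of edges incident to $y$.) A finite group $G$ is a maximal graph group if there is a connected graph $Y$ of genus $g\ge 2$ on which $G$ acts harmonically with $|G|=6(g-1)$. *)

theory Defs
  imports "HOL-Algebra.Group_Action" "HOL-Algebra.Generated_Groups" "HOL-Algebra.Multiplicative_Group"
begin

section \<open>Finite loopless multigraphs\<close>

record ('v, 'e) mgraph =
  verts :: "'v set"
  edges :: "'e set"
  ends :: "'e \<Rightarrow> 'v set"

definition multigraph :: "('v, 'e) mgraph \<Rightarrow> bool" where
  "multigraph X \<longleftrightarrow>
     finite (verts X) \<and> finite (edges X) \<and>
     (\<forall>e \<in> edges X. ends X e \<subseteq> verts X \<and> card (ends X e) = 2)"

definition adjacency :: "('v, 'e) mgraph \<Rightarrow> 'v rel" where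
  "adjacency X = {(u, v). \<exists>e \<in> edges X. ends X e = {u, v}}"

definition connected_graph :: "('v, 'e) mgraph \<Rightarrow> bool" where
  "connected_graph X \<longleftrightarrow>
     verts X \<noteq> {} \<and> (\<forall>u \<in> verts X. \<forall>v \<in> verts X. (u, v) \<in> (adjacency X)\<^sup>*)"

definition genus :: "('v, 'e) mgraph \<Rightarrow> int" where
  "genus X = int (card (edges X)) - int (card (verts X)) + 1"

definition incident_edges :: "('v, 'e) mgraph \<Rightarrow> 'v \<Rightarrow> 'e set" where
  "incident_edges X x = {e \<in> edges X. x \<in> ends X e}"

text \<open>Vertices and edges together form the disjoint union \<open>verts X <+> edges X\<close>;
  \<open>Inl\<close> tags vertices and \<open>Inr\<close> tags edges.\<close>

definition elements :: "('v, 'e) mgraph \<Rightarrow> ('v + 'e) set" where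
  "elements X = verts X <+> edges X"

text \<open>The connected component of the vertex \<open>u\<close>, as a set of vertices and edges.\<close>

definition component :: "('v, 'e) mgraph \<Rightarrow> 'v \<Rightarrow> ('v + 'e) set" where
  "component X u =
     (let C = {v \<in> verts X. (u, v) \<in> (adjacency X)\<^sup>*}
      in C <+> {e \<in> edges X. ends X e \<subseteq> C})"


section \<open>Harmonic morphisms\<close>

text \<open>In the first alternative the endpoints of \<open>e\<close> have distinct images whenever \<open>X\<close> is a
  multigraph, since \<open>ends X e'\<close> then has two elements; in the second, \<open>e\<close> is vertical.\<close>

definition graph_morphism ::
  "('v, 'e) mgraph \<Rightarrow> ('w, 'f) mgraph \<Rightarrow> ('v + 'e \<Rightarrow> 'w + 'f) \<Rightarrow> bool" where
  "graph_morphism Y X \<phi> \<longleftrightarrow>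
     (\<forall>y \<in> verts Y. \<phi> (Inl y) \<in> Inl ` verts X) \<and>
     (\<forall>e \<in> edges Y.
        (\<exists>e' \<in> edges X. \<phi> (Inr e) = Inr e' \<and> Inl ` ends X e' = \<phi> ` Inl ` ends Y e) \<or>
        (\<exists>x \<in> verts X. \<phi> (Inr e) = Inl x \<and> (\<forall>y \<in> ends Y e. \<phi> (Inl y) = Inl x)))"

definition harmonic_morphism ::
  "('v, 'e) mgraph \<Rightarrow> ('w, 'f) mgraph \<Rightarrow> ('v + 'e \<Rightarrow> 'w + 'f) \<Rightarrow> bool" where
  "harmonic_morphism Y X \<phi> \<longleftrightarrow>
     graph_morphism Y X \<phi> \<and>
     (\<forall>y \<in> verts Y. \<forall>x \<in> verts X. \<phi> (Inl y) = Inl x \<longrightarrow>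
        (\<forall>e1 \<in> incident_edges X x. \<forall>e2 \<in> incident_edges X x.
           card {e \<in> incident_edges Y y. \<phi> (Inr e) = Inr e1} =
           card {e \<in> incident_edges Y y. \<phi> (Inr e) = Inr e2}))"


section \<open>Group actions on graphs and quotient graphs\<close>

text \<open>Each group element acts as a bijection of \<open>elements Y\<close> that is a morphism; its inverse
  is the action of the inverse element, so it is an automorphism of \<open>Y\<close>.\<close>

definition graph_action ::
  "('g, 'm) monoid_scheme \<Rightarrow> ('v, 'e) mgraph \<Rightarrow> ('g \<Rightarrow> 'v + 'e \<Rightarrow> 'v + 'e) \<Rightarrow> bool" where
  "graph_action G Y act \<longleftrightarrow>
     group_action G (elements Y) act \<and> (\<forall>g \<in> carrier G. graph_morphism Y Y (act g))"

text \<open>The first conjunct says that \<open>G\<close> embeds in the automorphism group of \<open>Y\<close>, the second that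
  the setwise stabilizer of every connected component acts faithfully on that component.\<close>

definition faithful_graph_action ::
  "('g, 'm) monoid_scheme \<Rightarrow> ('v, 'e) mgraph \<Rightarrow> ('g \<Rightarrow> 'v + 'e \<Rightarrow> 'v + 'e) \<Rightarrow> bool" where
  "faithful_graph_action G Y act \<longleftrightarrow>
     graph_action G Y act \<and> faithful_action G (elements Y) act \<and>
     (\<forall>u \<in> verts Y.
        inj_on (\<lambda>g. restrict (act g) (component Y u))
          {g \<in> carrier G. act g ` component Y u = component Y u})"

definition vertex_orbit ::
  "('g, 'm) monoid_scheme \<Rightarrow> ('g \<Rightarrow> 'v + 'e \<Rightarrow> 'v + 'e) \<Rightarrow> 'v \<Rightarrow> ('v + 'e) set" where
  "vertex_orbit G act v = orbit G act (Inl v)"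

definition edge_orbit ::
  "('g, 'm) monoid_scheme \<Rightarrow> ('g \<Rightarrow> 'v + 'e \<Rightarrow> 'v + 'e) \<Rightarrow> 'e \<Rightarrow> ('v + 'e) set" where
  "edge_orbit G act e = orbit G act (Inr e)"

text \<open>The edges whose endpoints lie in different orbits.\<close>

definition nonvertical_edges ::
  "('g, 'm) monoid_scheme \<Rightarrow> ('v, 'e) mgraph \<Rightarrow> ('g \<Rightarrow> 'v + 'e \<Rightarrow> 'v + 'e) \<Rightarrow> 'e set" where
  "nonvertical_edges G Y act = {e \<in> edges Y. inj_on (vertex_orbit G act) (ends Y e)}"

definition quotient_graph ::
  "('g, 'm) monoid_scheme \<Rightarrow> ('v, 'e) mgraph \<Rightarrow> ('g \<Rightarrow> 'v + 'e \<Rightarrow> 'v + 'e)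
     \<Rightarrow> (('v + 'e) set, ('v + 'e) set) mgraph" where
  "quotient_graph G Y act =
     \<lparr>verts = vertex_orbit G act ` verts Y,
      edges = edge_orbit G act ` nonvertical_edges G Y act,
      ends = (\<lambda>c. {vertex_orbit G act v |v e. e \<in> edges Y \<and> Inr e \<in> c \<and> v \<in> ends Y e})\<rparr>"

text \<open>For a vertical edge \<open>e\<close> the set \<open>vertex_orbit G act ` ends Y e\<close> is a singleton, whose only
  member is the common orbit of the endpoints of \<open>e\<close>.\<close>

definition quotient_morphism ::
  "('g, 'm) monoid_scheme \<Rightarrow> ('v, 'e) mgraph \<Rightarrow> ('g \<Rightarrow> 'v + 'e \<Rightarrow> 'v + 'e)
     \<Rightarrow> 'v + 'e \<Rightarrow> ('v + 'e) set + ('v + 'e) set" where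
  "quotient_morphism G Y act z =
     (case z of
        Inl v \<Rightarrow> Inl (vertex_orbit G act v)
      | Inr e \<Rightarrow>
          if e \<in> nonvertical_edges G Y act then Inr (edge_orbit G act e)
          else Inl (the_elem (vertex_orbit G act ` ends Y e)))"

definition harmonic_action ::
  "('g, 'm) monoid_scheme \<Rightarrow> ('v, 'e) mgraph \<Rightarrow> ('g \<Rightarrow> 'v + 'e \<Rightarrow> 'v + 'e) \<Rightarrow> bool" where
  "harmonic_action G Y act \<longleftrightarrow>
     faithful_graph_action G Y act \<and>
     (\<forall>H. subgroup H G \<longrightarrow>
        harmonic_morphism Y (quotient_graph (G\<lparr>carrier := H\<rparr>) Y act)
          (quotient_morphism (G\<lparr>carrier := H\<rparr>) Y act))"

text \<open>Every finite multigraph is isomorphic to one whose vertices and edges are natural numbers,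
  so letting \<open>Y\<close> range over these loses no graph.\<close>

definition maximal_graph_group :: "('g, 'm) monoid_scheme \<Rightarrow> bool" where
  "maximal_graph_group G \<longleftrightarrow>
     group G \<and> finite (carrier G) \<and>
     (\<exists>(Y :: (nat, nat) mgraph) act.
        multigraph Y \<and> connected_graph Y \<and> genus Y \<ge> 2 \<and>
        harmonic_action G Y act \<and> int (order G) = 6 * (genus Y - 1))"


section \<open>Group presentations and the modular group\<close>

text \<open>Group words are lists of letters \<open>(a, b)\<close>, standing for the generator \<open>a\<close> if \<open>b\<close> holds and for
  its inverse otherwise. Two words are identified if this follows from free cancellation and from
  the relators \<open>R\<close> being trivial. The set of generators is the whole type \<open>'a\<close>.\<close>

inductive word_eq :: "('a \<times> bool) list set \<Rightarrow> ('a \<times> bool) list \<Rightarrow> ('a \<times> bool) list \<Rightarrow> bool"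
  for R where
  refl: "word_eq R u u"
| sym: "word_eq R u v \<Longrightarrow> word_eq R v u"
| trans: "word_eq R u v \<Longrightarrow> word_eq R v w \<Longrightarrow> word_eq R u w"
| append: "word_eq R u u' \<Longrightarrow> word_eq R v v' \<Longrightarrow> word_eq R (u @ v) (u' @ v')"
| cancel: "word_eq R [(a, b), (a, \<not> b)] []"
| relator: "r \<in> R \<Longrightarrow> word_eq R r []"

definition word_rel :: "('a \<times> bool) list set \<Rightarrow> ('a \<times> bool) list rel" where
  "word_rel R = {(u, v). word_eq R u v}"

definition presented_group :: "('a \<times> bool) list set \<Rightarrow> ('a \<times> bool) list set monoid" where
  "presented_group R =
     \<lparr>carrier = UNIV // word_rel R,
      mult = (\<lambda>A B. \<Union>u \<in> A. \<Union>v \<in> B. word_rel R `` {u @ v}),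
      one = word_rel R `` {[]}\<rparr>"

lemma equiv_word_rel: "equiv UNIV (word_rel R)"
  unfolding word_rel_def
  by (rule equivI)
    (auto simp: refl_on_def sym_def trans_def intro: word_eq.refl word_eq.sym word_eq.trans)

lemma presented_group_mult:
  "word_rel R `` {u} \<otimes>\<^bsub>presented_group R\<^esub> word_rel R `` {v} = word_rel R `` {u @ v}"
proof -
  have "(\<lambda>u v. word_rel R `` {u @ v}) respects2 word_rel R"
    by (rule congruent2I'[OF equiv_class_eq[OF equiv_word_rel]])
      (auto simp: word_rel_def intro: word_eq.append)
  then show ?thesis
    using UN_equiv_class2[OF equiv_word_rel equiv_word_rel, of R R "\<lambda>u v. word_rel R `` {u @ v}"]
    by (simp add: presented_group_def)
qed

lemma word_eq_inverse: "word_eq R (rev (map (\<lambda>(a, b). (a, \<not> b)) w) @ w) []"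
proof (induction w)
  case Nil
  show ?case by (simp add: word_eq.refl)
next
  case (Cons l w)
  obtain a b where l: "l = (a, b)" by (cases l)
  let ?i = "rev (map (\<lambda>(a, b). (a, \<not> b)) w)"
  have "word_eq R [(a, \<not> b), (a, b)] []"
    using word_eq.cancel[of R a "\<not> b"] by simp
  then have "word_eq R (?i @ ([(a, \<not> b), (a, b)] @ w)) (?i @ ([] @ w))"
    by (intro word_eq.append word_eq.refl)
  with Cons.IH show ?case
    by (auto simp: l intro: word_eq.trans)
qed

lemma group_presented_group: "group (presented_group R)"
proof -
  have carrier: "carrier (presented_group R) = range (\<lambda>u. word_rel R `` {u})"
    by (auto simp: presented_group_def quotient_def)
  have one: "\<one>\<^bsub>presented_group R\<^esub> = word_rel R `` {[]}"
    by (simp add: presented_group_def)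
  have inverse: "word_rel R `` {rev (map (\<lambda>(a, b). (a, \<not> b)) w) @ w} = word_rel R `` {[]}" for w
    by (rule equiv_class_eq[OF equiv_word_rel]) (simp add: word_rel_def word_eq_inverse)
  show ?thesis
  proof (rule groupI)
    fix x assume "x \<in> carrier (presented_group R)"
    then obtain w where "x = word_rel R `` {w}" by (auto simp: carrier)
    then have "word_rel R `` {rev (map (\<lambda>(a, b). (a, \<not> b)) w)} \<otimes>\<^bsub>presented_group R\<^esub> x =
        \<one>\<^bsub>presented_group R\<^esub>"
      by (simp only: presented_group_mult inverse one)
    then show "\<exists>y \<in> carrier (presented_group R).
        y \<otimes>\<^bsub>presented_group R\<^esub> x = \<one>\<^bsub>presented_group R\<^esub>"
      unfolding carrier by blast
  qed (auto simp: carrier one presented_group_mult)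
qed

datatype modular_gen = gen_x | gen_y

definition modular_group :: "(modular_gen \<times> bool) list set monoid" where
  "modular_group =
     presented_group {replicate 2 (gen_x, True), replicate 3 (gen_y, True)}"

definition is_quotient_of ::
  "('a, 'm) monoid_scheme \<Rightarrow> ('b, 'n) monoid_scheme \<Rightarrow> bool" where
  "is_quotient_of G K \<longleftrightarrow> (\<exists>N. N \<lhd> K \<and> K Mod N \<cong> G)"

end

theory Submission
  imports Defs "HOL-Algebra.Left_Coset"
begin

text \<open>If \<open>G\<close> acts harmonically on a connected graph, vertex stabilizers act freely on incident
  edges, so \<open>G\<close> acts freely on oriented edges (darts). Choose representatives \<open>T\<close> of the vertex
  orbits that span a subtree, with \<open>2(|T| - 1)\<close> darts, and let \<open>m\<close> be the number of orbits of the
  remaining darts. Counting darts, \<open>|G| = 6(g - 1)\<close> becomes the orbifold equation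
  \<open>3m + (\<Sum>t\<in>T. 6(1 - 1/|G\<^sub>t|)) = 7\<close>. Either \<open>m = 0\<close> and the nontrivial stabilizers have orders
  2 and 3, or \<open>m = 1\<close>, one stabilizer has order 3 and some involution reverses a dart of the
  remaining orbit. A subgroup that contains these elements moves \<open>T\<close> over the whole graph, so
  they generate \<open>G\<close>.

  Conversely, let \<open>G\<close> be generated by \<open>x\<close> of order 2 and \<open>y\<close> of order 3, and join the cosets
  \<open>g\<langle>x\<rangle>\<close> and \<open>g\<langle>y\<rangle>\<close> by an edge for each \<open>g\<close> in \<open>G\<close>. This bipartite graph has \<open>|G|\<close> edges
  and \<open>|G|/2 + |G|/3\<close> vertices, and \<open>G\<close> acts freely on its edges.\<close>

section \<open>Quotients of the modular group\<close>

lemma (in group_hom) is_quotient_of_if_surj: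
  assumes "h ` carrier G = carrier H"
  shows "is_quotient_of H G"
  unfolding is_quotient_of_def using normal_kernel FactGroup_iso[OF assms] by blast

lemma is_quotient_of_imp_surj_hom:
  assumes "is_quotient_of G K"
  obtains h where "h \<in> hom K G" "h ` carrier K = carrier G"
proof -
  obtain N \<phi> where N: "N \<lhd> K" and \<phi>: "\<phi> \<in> iso (K Mod N) G"
    using assms by (auto simp: is_quotient_of_def is_iso_def)
  have proj: "(\<lambda>a. N #>\<^bsub>K\<^esub> a) \<in> hom K (K Mod N)"
    using normal.r_coset_hom_Mod[OF N] .
  have "(\<lambda>a. N #>\<^bsub>K\<^esub> a) ` carrier K = carrier (K Mod N)"
    by (auto simp: FactGroup_def RCOSETS_def)
  moreover have "\<phi> ` carrier (K Mod N) = carrier G"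
    using \<phi> by (auto simp: iso_def bij_betw_def)
  ultimately have "(\<phi> \<circ> (\<lambda>a. N #>\<^bsub>K\<^esub> a)) ` carrier K = carrier G"
    by (simp only: image_comp[symmetric])
  moreover have "\<phi> \<circ> (\<lambda>a. N #>\<^bsub>K\<^esub> a) \<in> hom K G"
    using Group.hom_compose[OF proj, of \<phi> G] \<phi> by (simp add: iso_def)
  ultimately show ?thesis by (rule that[rotated])
qed

section \<open>The universal property of a group presentation\<close>

context group
begin

text \<open>The extension of \<open>f\<close> to a homomorphism on the free group, computed on words
  that need not be reduced.\<close>

primrec word_value :: "('g \<Rightarrow> 'a) \<Rightarrow> ('g \<times> bool) list \<Rightarrow> 'a" where
  "word_value f [] = \<one>"
| "word_value f (l # w) = (if snd l then f (fst l) else inv f (fst l)) \<otimes> word_value f w"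

lemma word_value_closed:
  assumes "range f \<subseteq> carrier G" shows "word_value f w \<in> carrier G"
  using assms by (induction w) auto

lemma word_value_append:
  assumes "range f \<subseteq> carrier G"
  shows "word_value f (u @ v) = word_value f u \<otimes> word_value f v"
proof (induction u)
  case Nil
  then show ?case by (simp add: word_value_closed[OF assms])
next
  case (Cons l u)
  have "f (fst l) \<in> carrier G" using assms by auto
  with Cons show ?case by (simp add: m_assoc word_value_closed[OF assms])
qed

text \<open>By induction on the derivation of \<open>word_eq\<close>: free cancellation holds in
  every group, relators have value \<open>\<one>\<close> by assumption, and
  \<open>word_value_append\<close> handles the congruence rule.\<close>

lemma word_value_eq:
  assumes f: "range f \<subseteq> carrier G" and R: "\<And>r. r \<in> R \<Longrightarrow> word_value f r = \<one>"
    and "word_eq R u v"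
  shows "word_value f u = word_value f v"
  using assms(3)
proof induction
  case (cancel a b)
  have "f a \<in> carrier G" using f by auto
  then show ?case by auto
qed (auto simp: word_value_append[OF f] R)

text \<open>Von Dyck's theorem. Words in one class have one value, so the image of a class under
  \<open>word_value f\<close> is a singleton and \<open>the_elem\<close> extracts its
  member.\<close>

lemma hom_from_presented_group:
  assumes f: "range f \<subseteq> carrier G" and R: "\<And>r. r \<in> R \<Longrightarrow> word_value f r = \<one>"
  obtains h where "h \<in> hom (presented_group R) G" "\<And>w. h (word_rel R `` {w}) = word_value f w"
proof
  let ?h = "\<lambda>A. the_elem (word_value f ` A)"
  show h: "?h (word_rel R `` {w}) = word_value f w" for w
  proof -
    define C where "C = word_rel R `` {w}"
    have "word_value f v = word_value f w" if "v \<in> C" for v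
      using that word_value_eq[OF f R, of R w v] by (simp add: word_rel_def C_def)
    moreover have "w \<in> C"
      by (simp add: C_def word_rel_def word_eq.refl)
    ultimately have "word_value f ` C = {word_value f w}"
      by blast
    then show ?thesis by (simp add: C_def)
  qed
  show "?h \<in> hom (presented_group R) G"
  proof (rule homI)
    fix A B assume "A \<in> carrier (presented_group R)" "B \<in> carrier (presented_group R)"
    then obtain u v where "A = word_rel R `` {u}" "B = word_rel R `` {v}"
      by (auto simp: presented_group_def quotient_def)
    then show "?h (A \<otimes>\<^bsub>presented_group R\<^esub> B) = ?h A \<otimes> ?h B"
      by (simp only: presented_group_mult h word_value_append[OF f])
  next
    fix A assume "A \<in> carrier (presented_group R)"
    then obtain u where "A = word_rel R `` {u}"
      by (auto simp: presented_group_def quotient_def)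
    then show "?h A \<in> carrier G" by (simp only: h word_value_closed[OF f])
  qed
qed

end

text \<open>A word is the product of its letters, and a negative letter is the inverse of a
  generator because the two-letter word cancels.\<close>

lemma generate_presented_group:
  "generate (presented_group R) (range (\<lambda>a. word_rel R `` {[(a, True)]})) =
     carrier (presented_group R)" (is "generate ?P ?S = _")
proof -
  interpret P: group ?P by (rule group_presented_group)
  have class_closed: "word_rel R `` {w} \<in> carrier ?P" for w
    by (simp add: presented_group_def quotientI)
  have S: "?S \<subseteq> carrier ?P"
    using class_closed by auto
  have one: "\<one>\<^bsub>?P\<^esub> = word_rel R `` {[]}"
    by (simp add: presented_group_def)
  have letter: "word_rel R `` {[(a, b)]} \<in> generate ?P ?S" for a b
  proof (cases b)
    case True
    then show ?thesis by (auto intro: generate.incl)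
  next
    case False
    have "word_rel R `` {[(a, False), (a, True)]} = word_rel R `` {[]}"
      by (rule equiv_class_eq[OF equiv_word_rel])
        (use word_eq.cancel[of R a False] in \<open>simp add: word_rel_def\<close>)
    then have "word_rel R `` {[(a, False)]} \<otimes>\<^bsub>?P\<^esub> word_rel R `` {[(a, True)]} = \<one>\<^bsub>?P\<^esub>"
      by (simp add: presented_group_mult one)
    then have "word_rel R `` {[(a, False)]} = inv\<^bsub>?P\<^esub> (word_rel R `` {[(a, True)]})"
      by (intro P.inv_equality[symmetric] class_closed)
    then show ?thesis
      using False by (auto intro: generate.inv)
  qed
  have "word_rel R `` {w} \<in> generate ?P ?S" for w
  proof (induction w)
    case Nil
    then show ?case by (metis one generate.one)
  next
    case (Cons l w)
    have "word_rel R `` {l # w} = word_rel R `` {[l]} \<otimes>\<^bsub>?P\<^esub> word_rel R `` {w}"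
      by (simp add: presented_group_mult)
    then show ?case
      using generate.eng[OF letter Cons.IH] by (metis surj_pair)
  qed
  then have "carrier ?P \<subseteq> generate ?P ?S"
    by (auto simp: presented_group_def quotient_def)
  then show ?thesis
    using P.generate_incl[OF S] by blast
qed

lemma UNIV_modular_gen: "UNIV = {gen_x, gen_y}"
  using modular_gen.exhaust by auto

text \<open>A surjection carries the two generators of the modular group to elements that satisfy
  the relations and generate; conversely, von Dyck's theorem turns such a pair into a surjection. At
  this stage \<open>x\<close> and \<open>y\<close> may still be trivial.\<close>

lemma (in group) is_quotient_of_modular_group_iff:
  "is_quotient_of G modular_group \<longleftrightarrow>
     (\<exists>x \<in> carrier G. \<exists>y \<in> carrier G.
        x [^] (2::nat) = \<one> \<and> y [^] (3::nat) = \<one> \<and> generate G {x, y} = carrier G)"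
    (is "?L \<longleftrightarrow> ?R")
proof -
  define rels where "rels = {replicate 2 (gen_x, True), replicate 3 (gen_y, True)}"
  have modular: "modular_group = presented_group rels"
    by (simp add: modular_group_def rels_def)
  let ?gen = "\<lambda>a. word_rel rels `` {[(a, True)]}"
  interpret M: group modular_group
    unfolding modular by (rule group_presented_group)
  have gen: "generate modular_group (range ?gen) = carrier modular_group"
    unfolding modular by (rule generate_presented_group)
  have gen_closed: "?gen a \<in> carrier modular_group" for a
    by (simp add: modular presented_group_def quotientI)
  have mult: "word_rel rels `` {u} \<otimes>\<^bsub>modular_group\<^esub> word_rel rels `` {v} =
      word_rel rels `` {u @ v}" for u v
    unfolding modular by (rule presented_group_mult)
  have relator: "word_rel rels `` {r} = \<one>\<^bsub>modular_group\<^esub>" if "r \<in> rels" for r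
  proof -
    have "word_rel rels `` {r} = word_rel rels `` {[]}"
      by (rule equiv_class_eq[OF equiv_word_rel])
        (use word_eq.relator[OF that] in \<open>simp add: word_rel_def\<close>)
    then show ?thesis by (simp add: modular presented_group_def)
  qed
  have rels: "replicate 2 (gen_x, True) \<in> rels" "replicate 3 (gen_y, True) \<in> rels"
    by (simp_all add: rels_def)
  show ?thesis
  proof
    assume ?L
    then obtain h where h: "h \<in> hom modular_group G" and surj: "h ` carrier modular_group = carrier G"
      by (rule is_quotient_of_imp_surj_hom)
    interpret h: group_hom modular_group G h
      using h by unfold_locales
    have "?gen gen_x [^]\<^bsub>modular_group\<^esub> (2::nat) = \<one>\<^bsub>modular_group\<^esub>"
      using relator[OF rels(1)] gen_closed[of gen_x] by (simp add: numeral_eq_Suc mult)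
    then have "h (?gen gen_x) [^] (2::nat) = \<one>"
      by (simp add: h.hom_nat_pow[symmetric] gen_closed)
    moreover have "?gen gen_y [^]\<^bsub>modular_group\<^esub> (3::nat) = \<one>\<^bsub>modular_group\<^esub>"
      using relator[OF rels(2)] gen_closed[of gen_y] by (simp add: numeral_eq_Suc mult)
    then have "h (?gen gen_y) [^] (3::nat) = \<one>"
      by (simp add: h.hom_nat_pow[symmetric] gen_closed)
    moreover have "generate G {h (?gen gen_x), h (?gen gen_y)} = carrier G"
      using h.generate_img[of "range ?gen"] gen_closed gen surj
      by (simp add: image_subset_iff UNIV_modular_gen)
    ultimately show ?R
      using gen_closed h.hom_closed by blast
  next
    assume ?R
    then obtain x y where xy: "x \<in> carrier G" "y \<in> carrier G" "x [^] (2::nat) = \<one>"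
      "y [^] (3::nat) = \<one>" "generate G {x, y} = carrier G" by blast
    define f where "f a = (case a of gen_x \<Rightarrow> x | gen_y \<Rightarrow> y)" for a
    have f: "range f \<subseteq> carrier G"
      using xy(1,2) by (simp add: UNIV_modular_gen f_def)
    have "word_value f r = \<one>" if "r \<in> rels" for r
      using that xy(1-4) by (auto simp: rels_def numeral_eq_Suc f_def m_assoc)
    from hom_from_presented_group[OF f this] obtain h
      where h: "h \<in> hom modular_group G" "\<And>w. h (word_rel rels `` {w}) = word_value f w"
      unfolding modular by blast
    interpret h: group_hom modular_group G h
      using h(1) by unfold_locales
    have "h ` range ?gen = {x, y}"
      using xy(1,2) by (simp add: h(2) UNIV_modular_gen f_def)
    then have "h ` carrier modular_group = carrier G"
      using h.generate_img[OF image_subsetI, of UNIV ?gen] gen_closed gen xy(5) by simp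
    then show ?L
      by (rule h.is_quotient_of_if_surj)
  qed
qed

section \<open>Exact orders of the two generators\<close>

lemma dvd_two_or_three:
  fixes n p :: nat
  assumes "n dvd p" "p = 2 \<or> p = 3"
  shows "n = 1 \<or> n = p"
proof -
  have "n > 0" "n \<le> 3"
    using assms dvd_imp_le[of n p] dvd_pos_nat[of p n] by auto
  then have "n = 1 \<or> n = 2 \<or> n = 3" by linarith
  then show ?thesis using assms by auto
qed

text \<open>The set \<open>{\<one>, a}\<close> is what a generating pair becomes when one of its
  members is trivial; the group is then cyclic.\<close>

lemma (in group) order_le_if_generated_by_one:
  assumes "a \<in> carrier G" "generate G {\<one>, a} = carrier G" "a [^] n = \<one>" "0 < (n::nat)"
  shows "order G \<le> n"
proof -
  have "generate G {\<one>, a} \<subseteq> generate G {a}"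
    by (intro generate_subgroup_incl generate_is_subgroup)
      (use assms in \<open>auto intro: generate.intros\<close>)
  then have "carrier G = generate G {a}"
    using assms generate_incl[of "{a}"] by auto
  then have "order G = ord a"
    using assms(1) generate_pow_card by (simp add: order_def)
  also have "ord a \<le> n"
    using assms by (intro dvd_imp_le) (simp_all add: pow_eq_id)
  finally show ?thesis .
qed

text \<open>If one generator were trivial, the group would be cyclic of order at most 3. Both are
  therefore nontrivial, and since 2 and 3 are prime their orders are exact.\<close>

lemma (in group) is_quotient_of_modular_group_iff_ord:
  assumes "order G \<ge> 6"
  shows "is_quotient_of G modular_group \<longleftrightarrow>
     (\<exists>x \<in> carrier G. \<exists>y \<in> carrier G. ord x = 2 \<and> ord y = 3 \<and> generate G {x, y} = carrier G)"
proof -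
  have "ord x = 2 \<and> ord y = 3 \<longleftrightarrow> x [^] (2::nat) = \<one> \<and> y [^] (3::nat) = \<one>"
    if xy: "x \<in> carrier G" "y \<in> carrier G" "generate G {x, y} = carrier G" for x y
  proof
    assume pow: "x [^] (2::nat) = \<one> \<and> y [^] (3::nat) = \<one>"
    have "x \<noteq> \<one>"
      using order_le_if_generated_by_one[of y 3] xy pow assms by fastforce
    moreover have "y \<noteq> \<one>"
      using order_le_if_generated_by_one[of x 2] xy pow assms by (fastforce simp: insert_commute)
    ultimately have "ord x \<noteq> 1" "ord y \<noteq> 1"
      using xy ord_eq_1 by blast+
    moreover have "ord x dvd 2" "ord y dvd 3"
      using xy pow pow_eq_id by blast+
    ultimately show "ord x = 2 \<and> ord y = 3"
      using dvd_two_or_three by blast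
  next
    assume "ord x = 2 \<and> ord y = 3"
    then show "x [^] (2::nat) = \<one> \<and> y [^] (3::nat) = \<one>"
      using pow_ord_eq_1[OF xy(1)] pow_ord_eq_1[OF xy(2)] by simp
  qed
  then show ?thesis
    unfolding is_quotient_of_modular_group_iff by metis
qed

section \<open>Actions on graphs\<close>

text \<open>\<open>BijGroup E\<close> consists of extensional functions, so the action has to be cut
  down to \<open>E\<close>. The inverse of \<open>f g\<close> on \<open>E\<close> is
  \<open>f (inv g)\<close>.\<close>

lemma (in group) group_action_restrictI:
  assumes "\<And>g x. g \<in> carrier G \<Longrightarrow> x \<in> E \<Longrightarrow> f g x \<in> E"
    and "\<And>x. x \<in> E \<Longrightarrow> f \<one> x = x"
    and "\<And>g h x. g \<in> carrier G \<Longrightarrow> h \<in> carrier G \<Longrightarrow> x \<in> E \<Longrightarrow> f (g \<otimes> h) x = f g (f h x)"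
  shows "group_action G E (\<lambda>g. restrict (f g) E)"
proof -
  have Bij: "restrict (f g) E \<in> Bij E" if "g \<in> carrier G" for g
  proof -
    have "bij_betw (restrict (f g) E) E E"
    proof (rule bij_betw_byWitness[where f' = "f (inv g)"])
      show "\<forall>x\<in>E. f (inv g) (restrict (f g) E x) = x"
        using that assms(2) assms(3)[of "inv g" g] by simp
      show "\<forall>x\<in>E. restrict (f g) E (f (inv g) x) = x"
        using that assms(1)[of "inv g"] assms(2) assms(3)[of g "inv g"] by simp
    qed (use that assms(1) in auto)
    then show ?thesis by (simp add: Bij_def)
  qed
  have "(\<lambda>g. restrict (f g) E) \<in> hom G (BijGroup E)"
  proof (rule homI)
    fix g h assume gh: "g \<in> carrier G" "h \<in> carrier G"
    have "restrict (f (g \<otimes> h)) E = compose E (restrict (f g) E) (restrict (f h) E)"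
      using gh assms(1,3) by (auto simp: compose_def restrict_def)
    then show "restrict (f (g \<otimes> h)) E =
        restrict (f g) E \<otimes>\<^bsub>BijGroup E\<^esub> restrict (f h) E"
      using gh Bij by (simp add: BijGroup_def)
  qed (simp add: BijGroup_def Bij)
  then show ?thesis
    by (simp add: group_action_def group_hom_def group_hom_axioms_def group_BijGroup)
qed

lemma Inl_elements [simp]: "Inl v \<in> elements Y \<longleftrightarrow> v \<in> verts Y"
  and Inr_elements [simp]: "Inr e \<in> elements Y \<longleftrightarrow> e \<in> edges Y"
  by (auto simp: elements_def)

text \<open>The common setting for the group and each of its subgroups, over which
  \<open>harmonic_action\<close> quantifies.\<close>

locale acting_group = group_action G "elements Y" act
  for G (structure) and Y :: "('v, 'e) mgraph" and act +
  assumes multigraph: "multigraph Y"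
    and morphism: "g \<in> carrier G \<Longrightarrow> graph_morphism Y Y (act g)"

lemma acting_group_iff:
  "acting_group G Y act \<longleftrightarrow> multigraph Y \<and> graph_action G Y act"
  by (auto simp: acting_group_def acting_group_axioms_def graph_action_def)

context acting_group
begin

sublocale group G
  using group_hom by (simp add: group_hom_def)

text \<open>\<open>vact\<close> and \<open>eact\<close> are the action with the tags of the sum type
  stripped. They are meaningful on \<open>verts Y\<close> and \<open>edges Y\<close>, where
  \<open>act_Inl\<close> and \<open>act_Inr\<close> show that the kind of an element is
  preserved.\<close>

definition vact where "vact g v = projl (act g (Inl v))"
definition eact where "eact g e = projr (act g (Inr e))"

lemma finite_graph: "finite (verts Y)" "finite (edges Y)"
  using multigraph by (auto simp: multigraph_def)

lemma ends_subset: "e \<in> edges Y \<Longrightarrow> ends Y e \<subseteq> verts Y"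
  and card_ends: "e \<in> edges Y \<Longrightarrow> card (ends Y e) = 2"
  using multigraph by (auto simp: multigraph_def)

lemma act_Inl:
  assumes "g \<in> carrier G" "v \<in> verts Y"
  shows "act g (Inl v) = Inl (vact g v)" and "vact g v \<in> verts Y"
  using morphism[OF assms(1)] assms(2) by (auto simp: graph_morphism_def vact_def)

text \<open>An automorphism cannot collapse an edge: it is injective on vertices, so the two ends
  keep distinct images and the vertical alternative of \<open>graph_morphism\<close> is
  impossible.\<close>

lemma act_Inr:
  assumes "g \<in> carrier G" "e \<in> edges Y"
  shows "act g (Inr e) = Inr (eact g e)" and "eact g e \<in> edges Y"
    and "ends Y (eact g e) = vact g ` ends Y e"
proof -
  have ends: "act g (Inl v) = Inl (vact g v)" "Inl v \<in> elements Y" if "v \<in> ends Y e" for v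
    using that ends_subset[OF assms(2)] act_Inl(1)[OF assms(1)] by auto
  have "inj_on (vact g) (ends Y e)"
  proof (rule inj_onI)
    fix u v assume uv: "u \<in> ends Y e" "v \<in> ends Y e" "vact g u = vact g v"
    then have "act g (Inl u) = act g (Inl v)"
      by (simp add: ends)
    then show "u = v"
      using inj_onD[OF inj_prop[OF assms(1)], of "Inl u" "Inl v"] ends(2) uv(1,2) by blast
  qed
  then have "card (vact g ` ends Y e) = 2"
    using card_ends[OF assms(2)] by (simp add: card_image)
  moreover have "card (vact g ` ends Y e) \<le> 1" if "\<forall>y \<in> ends Y e. act g (Inl y) = Inl x" for x
  proof -
    have "vact g ` ends Y e \<subseteq> {x}"
      using that by (auto simp: vact_def)
    then show ?thesis
      using card_mono[of "{x}"] by fastforce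
  qed
  ultimately have "\<not> (\<forall>y \<in> ends Y e. act g (Inl y) = Inl x)" for x
    by fastforce
  then obtain e' where e': "e' \<in> edges Y" "act g (Inr e) = Inr e'"
      "Inl ` ends Y e' = act g ` Inl ` ends Y e"
    using morphism[OF assms(1)] assms(2) unfolding graph_morphism_def by blast
  then show "act g (Inr e) = Inr (eact g e)" "eact g e \<in> edges Y"
    by (simp_all add: eact_def)
  have "act g ` Inl ` ends Y e = Inl ` vact g ` ends Y e"
    unfolding image_image by (rule image_cong[OF HOL.refl ends(1)])
  then show "ends Y (eact g e) = vact g ` ends Y e"
    using e' by (simp add: eact_def inj_image_eq_iff)
qed

lemma act_one [simp]: "x \<in> elements Y \<Longrightarrow> act \<one> x = x"
  using id_eq_one by (metis restrict_apply')

lemma vact_one [simp]: "v \<in> verts Y \<Longrightarrow> vact \<one> v = v"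
  and eact_one [simp]: "e \<in> edges Y \<Longrightarrow> eact \<one> e = e"
  by (simp_all add: vact_def eact_def)

lemma vact_mult:
  "\<lbrakk>g \<in> carrier G; h \<in> carrier G; v \<in> verts Y\<rbrakk> \<Longrightarrow> vact (g \<otimes> h) v = vact g (vact h v)"
  using composition_rule[of "Inl v" g h] by (simp add: act_Inl)

lemma eact_mult:
  "\<lbrakk>g \<in> carrier G; h \<in> carrier G; e \<in> edges Y\<rbrakk> \<Longrightarrow> eact (g \<otimes> h) e = eact g (eact h e)"
  using composition_rule[of "Inr e" g h] by (simp add: act_Inr)

lemma vact_inv [simp]:
  "\<lbrakk>g \<in> carrier G; v \<in> verts Y\<rbrakk> \<Longrightarrow> vact (inv g) (vact g v) = v"
  using vact_mult[of "inv g" g v] by simp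

lemma eact_inv [simp]:
  "\<lbrakk>g \<in> carrier G; e \<in> edges Y\<rbrakk> \<Longrightarrow> eact (inv g) (eact g e) = e"
  using eact_mult[of "inv g" g e] by simp

lemma eact_cancel:
  assumes "\<And>k. \<lbrakk>k \<in> carrier G; eact k e = e\<rbrakk> \<Longrightarrow> k = \<one>"
    and "g \<in> carrier G" "h \<in> carrier G" "e \<in> edges Y" "eact g e = eact h e"
  shows "g = h"
proof -
  have "inv h \<otimes> g = \<one>"
    using assms by (intro assms(1)) (simp_all add: eact_mult)
  then show ?thesis
    using assms(2,3) by (metis inv_equality inv_inv inv_closed)
qed

section \<open>Orbits and the quotient graph\<close>

lemma orbit_act:
  assumes g: "g \<in> carrier G" and x: "x \<in> elements Y"
  shows "orbit G act (act g x) = orbit G act x"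
proof (intro equalityI subsetI)
  fix z assume "z \<in> orbit G act (act g x)"
  then obtain h where h: "h \<in> carrier G" "z = act h (act g x)"
    by (auto simp: orbit_def)
  then have "z = act (h \<otimes> g) x"
    using g x by (simp add: composition_rule)
  then show "z \<in> orbit G act x"
    using g h(1) by (auto simp: orbit_def)
next
  fix z assume "z \<in> orbit G act x"
  then obtain h where h: "h \<in> carrier G" "z = act h x"
    by (auto simp: orbit_def)
  have "act (inv g) (act g x) = x"
    using orbit_sym_aux[OF g x HOL.refl] .
  then have "z = act (h \<otimes> inv g) (act g x)"
    using g h x element_image[OF g x HOL.refl] by (simp add: composition_rule)
  then show "z \<in> orbit G act (act g x)"
    using g h(1) by (auto simp: orbit_def)
qed

lemma Inl_in_vertex_orbit:
  assumes "v \<in> verts Y"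
  shows "Inl u \<in> vertex_orbit G act v \<longleftrightarrow> (\<exists>g \<in> carrier G. u = vact g v)"
proof -
  have "Inl u \<in> vertex_orbit G act v \<longleftrightarrow> (\<exists>g \<in> carrier G. Inl u = act g (Inl v))"
    by (auto simp: vertex_orbit_def orbit_def)
  then show ?thesis
    using assms by (simp add: act_Inl cong: bex_cong)
qed

lemma Inr_in_edge_orbit:
  assumes "e \<in> edges Y"
  shows "Inr e' \<in> edge_orbit G act e \<longleftrightarrow> (\<exists>g \<in> carrier G. e' = eact g e)"
proof -
  have "Inr e' \<in> edge_orbit G act e \<longleftrightarrow> (\<exists>g \<in> carrier G. Inr e' = act g (Inr e))"
    by (auto simp: edge_orbit_def orbit_def)
  then show ?thesis
    using assms by (simp add: act_Inr cong: bex_cong)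
qed

lemma vertex_orbit_vact:
  "\<lbrakk>g \<in> carrier G; v \<in> verts Y\<rbrakk> \<Longrightarrow> vertex_orbit G act (vact g v) = vertex_orbit G act v"
  using orbit_act[of g "Inl v"] by (simp add: vertex_orbit_def act_Inl)

lemma edge_orbit_eact:
  "\<lbrakk>g \<in> carrier G; e \<in> edges Y\<rbrakk> \<Longrightarrow> edge_orbit G act (eact g e) = edge_orbit G act e"
  using orbit_act[of g "Inr e"] by (simp add: edge_orbit_def act_Inr)

lemma vertex_orbit_eq_iff:
  assumes "u \<in> verts Y" "v \<in> verts Y"
  shows "vertex_orbit G act u = vertex_orbit G act v \<longleftrightarrow> (\<exists>g \<in> carrier G. u = vact g v)"
  using assms Inl_in_vertex_orbit vertex_orbit_vact by (metis one_closed vact_one)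

lemma edge_orbit_eq_iff:
  assumes "e \<in> edges Y" "e' \<in> edges Y"
  shows "edge_orbit G act e = edge_orbit G act e' \<longleftrightarrow> (\<exists>g \<in> carrier G. e = eact g e')"
  using assms Inr_in_edge_orbit edge_orbit_eact by (metis one_closed eact_one)

text \<open>The ends of a quotient edge do not depend on the representative, since translating an
  edge moves its ends within their orbits.\<close>

lemma ends_quotient_graph:
  assumes "e \<in> edges Y"
  shows "ends (quotient_graph G Y act) (edge_orbit G act e) = vertex_orbit G act ` ends Y e"
proof -
  have "vertex_orbit G act v \<in> vertex_orbit G act ` ends Y e"
    if "g \<in> carrier G" "v \<in> ends Y (eact g e)" for g v
    using that assms ends_subset[OF assms] by (auto simp: act_Inr vertex_orbit_vact subset_iff)
  moreover have "\<exists>g \<in> carrier G. e = eact g e"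
    using assms by (metis eact_one one_closed)
  ultimately show ?thesis
    using assms by (auto simp: quotient_graph_def Inr_in_edge_orbit)
qed

lemma subgroup_acting_group:
  assumes "subgroup H G"
  shows "acting_group (G\<lparr>carrier := H\<rparr>) Y act"
proof -
  have "group_action (G\<lparr>carrier := H\<rparr>) (elements Y) act"
    using induced_action[OF assms] .
  then show ?thesis
    using multigraph morphism subgroup.mem_carrier[OF assms]
    by (simp add: acting_group_def acting_group_axioms_def)
qed

lemma graph_morphism_quotient:
  assumes nonvertical: "nonvertical_edges G Y act = edges Y"
  shows "graph_morphism Y (quotient_graph G Y act) (quotient_morphism G Y act)"
proof -
  have "\<exists>e' \<in> edges (quotient_graph G Y act). quotient_morphism G Y act (Inr e) = Inr e' \<and>
      Inl ` ends (quotient_graph G Y act) e' = quotient_morphism G Y act ` Inl ` ends Y e"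
    if "e \<in> edges Y" for e
  proof (rule bexI[where x = "edge_orbit G act e"])
    show "edge_orbit G act e \<in> edges (quotient_graph G Y act)"
      using that nonvertical by (simp add: quotient_graph_def)
  qed (use that nonvertical ends_quotient_graph in \<open>simp add: quotient_morphism_def image_image\<close>)
  then show ?thesis
    by (simp add: graph_morphism_def quotient_graph_def quotient_morphism_def)
qed

text \<open>The edges at \<open>y\<close> over a given quotient edge form one free orbit of the
  stabilizer of \<open>y\<close>, so their number is the order of that stabilizer, whichever
  quotient edge is chosen. The assumption \<open>transverse\<close> excludes vertical edges and
  makes every element that carries one edge at \<open>y\<close> to another fix
  \<open>y\<close>.\<close>

lemma harmonic_morphism_quotient:
  assumes free: "\<And>g e. \<lbrakk>g \<in> carrier G; e \<in> edges Y; eact g e = e\<rbrakk> \<Longrightarrow> g = \<one>"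
    and transverse: "\<And>g e u. \<lbrakk>g \<in> carrier G; e \<in> edges Y; u \<in> ends Y e; vact g u \<in> ends Y e\<rbrakk>
      \<Longrightarrow> vact g u = u"
  shows "harmonic_morphism Y (quotient_graph G Y act) (quotient_morphism G Y act)"
proof -
  let ?Q = "quotient_graph G Y act" and ?\<phi> = "quotient_morphism G Y act"
  have nonvertical: "nonvertical_edges G Y act = edges Y"
  proof -
    have "inj_on (vertex_orbit G act) (ends Y e)" if e: "e \<in> edges Y" for e
    proof (rule inj_onI)
      fix u v assume uv: "u \<in> ends Y e" "v \<in> ends Y e"
        and eq: "vertex_orbit G act u = vertex_orbit G act v"
      have "u \<in> verts Y" "v \<in> verts Y"
        using uv ends_subset[OF e] by auto
      then obtain g where "g \<in> carrier G" "u = vact g v"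
        using eq vertex_orbit_eq_iff by blast
      then show "u = v"
        using transverse[OF _ e uv(2)] uv(1) by simp
    qed
    then show ?thesis by (auto simp: nonvertical_edges_def)
  qed
  have count: "card {e \<in> incident_edges Y y. ?\<phi> (Inr e) = Inr c} =
      card {g \<in> carrier G. vact g y = y}"
    if y: "y \<in> verts Y" and c: "c \<in> incident_edges ?Q (vertex_orbit G act y)" for y c
  proof -
    obtain e1 where e1: "e1 \<in> edges Y" "c = edge_orbit G act e1"
      using c by (auto simp: incident_edges_def quotient_graph_def nonvertical)
    then obtain v where v: "v \<in> ends Y e1" "vertex_orbit G act y = vertex_orbit G act v"
      using c by (auto simp: incident_edges_def ends_quotient_graph)
    have "v \<in> verts Y"
      using v(1) ends_subset[OF e1(1)] by auto
    then obtain h where h: "h \<in> carrier G" "y = vact h v"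
      using v(2) y vertex_orbit_eq_iff by blast
    \<comment> \<open>Translating by \<open>h\<close> yields a representative of \<open>c\<close>
      that is incident to \<open>y\<close> itself.\<close>
    define e0 where "e0 = eact h e1"
    have e0: "e0 \<in> edges Y" "y \<in> ends Y e0" "c = edge_orbit G act e0"
      using h e1 v(1) by (auto simp: e0_def act_Inr edge_orbit_eact)
    have "bij_betw (\<lambda>g. eact g e0) {g \<in> carrier G. vact g y = y}
        {e \<in> incident_edges Y y. ?\<phi> (Inr e) = Inr c}"
      unfolding bij_betw_def
    proof
      show "inj_on (\<lambda>g. eact g e0) {g \<in> carrier G. vact g y = y}"
        using eact_cancel[of e0] free e0(1) by (auto intro!: inj_onI)
      show "(\<lambda>g. eact g e0) ` {g \<in> carrier G. vact g y = y} =
          {e \<in> incident_edges Y y. ?\<phi> (Inr e) = Inr c}"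
      proof (intro equalityI subsetI)
        fix e assume "e \<in> (\<lambda>g. eact g e0) ` {g \<in> carrier G. vact g y = y}"
        then obtain g where g: "g \<in> carrier G" "vact g y = y" "e = eact g e0" by blast
        have "y \<in> ends Y e"
          using act_Inr(3)[OF g(1) e0(1)] g e0(2) by (metis imageI)
        then show "e \<in> {e \<in> incident_edges Y y. ?\<phi> (Inr e) = Inr c}"
          using g e0 act_Inr(2)[OF g(1) e0(1)]
          by (simp add: incident_edges_def quotient_morphism_def nonvertical edge_orbit_eact)
      next
        fix e assume "e \<in> {e \<in> incident_edges Y y. ?\<phi> (Inr e) = Inr c}"
        then have e: "e \<in> edges Y" "y \<in> ends Y e" "edge_orbit G act e = edge_orbit G act e0"
          by (auto simp: incident_edges_def quotient_morphism_def nonvertical e0(3))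
        then obtain g where g: "g \<in> carrier G" "e = eact g e0"
          using edge_orbit_eq_iff e0(1) by blast
        \<comment> \<open>Both \<open>y\<close> and its translate are ends of \<open>e\<close>, so
          \<open>transverse\<close> puts \<open>g\<close> in the stabilizer.\<close>
        have "vact g y \<in> ends Y e"
          using act_Inr(3)[OF g(1) e0(1)] g(2) e0(2) by simp
        then show "e \<in> (\<lambda>g. eact g e0) ` {g \<in> carrier G. vact g y = y}"
          using transverse[OF g(1) e(1,2)] g by blast
      qed
    qed
    then show ?thesis
      by (simp add: bij_betw_same_card)
  qed
  have "card {e \<in> incident_edges Y y. ?\<phi> (Inr e) = Inr e1} =
      card {e \<in> incident_edges Y y. ?\<phi> (Inr e) = Inr e2}"
    if "y \<in> verts Y" "?\<phi> (Inl y) = Inl x" "e1 \<in> incident_edges ?Q x" "e2 \<in> incident_edges ?Q x"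
    for x y e1 e2
  proof -
    have "x = vertex_orbit G act y"
      using that(2) by (simp add: quotient_morphism_def)
    then show ?thesis
      using count that by simp
  qed
  then show ?thesis
    unfolding harmonic_morphism_def using graph_morphism_quotient[OF nonvertical] by blast
qed

lemma component_eq_elements:
  assumes "connected_graph Y" "u \<in> verts Y"
  shows "component Y u = elements Y"
proof -
  have "{v \<in> verts Y. (u, v) \<in> (adjacency Y)\<^sup>*} = verts Y"
    using assms by (auto simp: connected_graph_def)
  moreover have "{e \<in> edges Y. ends Y e \<subseteq> verts Y} = edges Y"
    using ends_subset by auto
  ultimately show ?thesis
    by (simp add: component_def elements_def)
qed

text \<open>A single edge with trivial stabilizer forces faithfulness, and connectedness makes the
  whole graph the only component. Both \<open>free\<close> and \<open>transverse\<close> are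
  inherited by subgroups, so the quotient by each subgroup is harmonic.\<close>

lemma harmonic_actionI:
  assumes connected: "connected_graph Y" and edge: "edges Y \<noteq> {}"
    and free: "\<And>g e. \<lbrakk>g \<in> carrier G; e \<in> edges Y; eact g e = e\<rbrakk> \<Longrightarrow> g = \<one>"
    and transverse: "\<And>g e u. \<lbrakk>g \<in> carrier G; e \<in> edges Y; u \<in> ends Y e; vact g u \<in> ends Y e\<rbrakk>
      \<Longrightarrow> vact g u = u"
  shows "harmonic_action G Y act"
proof -
  obtain e where e: "e \<in> edges Y"
    using edge by auto
  have inj: "g = h" if "g \<in> carrier G" "h \<in> carrier G" "act g (Inr e) = act h (Inr e)" for g h
    using eact_cancel[of e g h] free that e by (simp add: eact_def)
  have "inj_on act (carrier G)"
    by (rule inj_onI) (simp add: inj)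
  moreover have "inj_on (\<lambda>g. restrict (act g) (component Y u))
      {g \<in> carrier G. act g ` component Y u = component Y u}" if "u \<in> verts Y" for u
  proof (rule inj_onI)
    fix g h assume gh: "g \<in> {g \<in> carrier G. act g ` component Y u = component Y u}"
      "h \<in> {g \<in> carrier G. act g ` component Y u = component Y u}"
      "restrict (act g) (component Y u) = restrict (act h) (component Y u)"
    have "act g (Inr e) = act h (Inr e)"
      using fun_cong[OF gh(3), of "Inr e"] e by (simp add: component_eq_elements[OF connected that])
    then show "g = h"
      using gh inj by blast
  qed
  ultimately have "faithful_graph_action G Y act"
    using morphism group_action_axioms
    by (simp add: faithful_graph_action_def graph_action_def faithful_action_def
        faithful_action_axioms_def)
  moreover have "harmonic_morphism Y (quotient_graph (G\<lparr>carrier := H\<rparr>) Y act)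
      (quotient_morphism (G\<lparr>carrier := H\<rparr>) Y act)" if H: "subgroup H G" for H
  proof -
    interpret H: acting_group "G\<lparr>carrier := H\<rparr>" Y act
      by (rule subgroup_acting_group[OF H])
    show ?thesis
      by (rule H.harmonic_morphism_quotient)
        (use free transverse subgroup.mem_carrier[OF H] in \<open>auto simp: H.eact_def H.vact_def eact_def vact_def\<close>)
  qed
  ultimately show ?thesis
    by (simp add: harmonic_action_def)
qed

end

section \<open>The coset graph\<close>

lemma adjacency_sym: "sym (adjacency X)"
  by (auto simp: adjacency_def sym_def insert_commute)

lemma (in subgroup) l_coset_mult_mem:
  assumes "group G" "g \<in> carrier G" "h \<in> H"
  shows "(g \<otimes> h) <# H = g <# H"
proof -
  interpret group G by fact
  have "(g \<otimes> h) <# H = g <# (h <# H)"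
    using assms by (simp add: lcos_m_assoc subset)
  then show ?thesis
    using assms(3) subgroup_axioms by (simp add: coset_join3 mem_carrier)
qed

lemma (in group) card_l_coset:
  assumes "subgroup H G" "g \<in> carrier G"
  shows "card (g <# H) = card H"
proof -
  have "g <# H = (\<lambda>h. g \<otimes> h) ` H"
    by (auto simp: l_coset_def)
  moreover have "inj_on (\<lambda>h. g \<otimes> h) H"
    using assms subgroup.mem_carrier by (fastforce intro: inj_onI)
  ultimately show ?thesis
    by (simp add: card_image)
qed

text \<open>Left multiplication is simply transitive on the edges and preserves the two kinds of
  cosets, so no edge becomes vertical. The genus minus 1 is |G| - |G|/2 - |G|/3 = |G|/6.\<close>

lemma (in group) maximal_graph_group_if_generated:
  assumes fin: "finite (carrier G)" and order: "order G \<ge> 6"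
    and A: "subgroup A G" "card A = 2" and B: "subgroup B G" "card B = 3"
    and gen: "generate G (A \<union> B) = carrier G"
  shows "maximal_graph_group G"
proof -
  define V where "V = lcosets A \<union> lcosets B"
  interpret A: subgroup A G by (rule A(1))
  interpret B: subgroup B G by (rule B(1))
  have cosets: "lcosets H = (\<lambda>g. g <# H) ` carrier G" for H
    by (auto simp: LCOSETS_def)
  have finite_V: "finite V"
    using fin by (simp add: V_def cosets)
  obtain c :: "'a \<Rightarrow> nat" where c: "inj_on c (carrier G)"
    using finite_imp_inj_to_nat_seg[OF fin] by blast
  obtain d :: "'a set \<Rightarrow> nat" where d: "inj_on d V"
    using finite_imp_inj_to_nat_seg[OF finite_V] by blast
  have V_subset: "C \<subseteq> carrier G" if "C \<in> V" for C
    using that l_coset_subset_G A.subset B.subset by (auto simp: V_def cosets)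
  have V_closed: "g <# C \<in> V" if "g \<in> carrier G" "C \<in> V" for g C
    using that by (auto simp: V_def cosets lcos_m_assoc A.subset B.subset)
  have coset_neq: "g <# A \<noteq> h <# B" if "g \<in> carrier G" "h \<in> carrier G" for g h
    using card_l_coset[OF A(1) that(1)] card_l_coset[OF B(1) that(2)] A(2) B(2) by auto
  have in_V: "g <# A \<in> V" "g <# B \<in> V" if "g \<in> carrier G" for g
    using that by (auto simp: V_def cosets)
  \<comment> \<open>\<open>c\<close> and \<open>d\<close> code edges and vertices as numbers; cosets of \<open>A\<close> and of \<open>B\<close> are told apart by
    their size.\<close>
  define Y :: "(nat, nat) mgraph" where
    "Y = \<lparr>verts = d ` V, edges = c ` carrier G,
          ends = (\<lambda>n. let g = inv_into (carrier G) c n in {d (g <# A), d (g <# B)})\<rparr>"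
  define f where "f g z =
      (case z of Inl n \<Rightarrow> Inl (d (g <# inv_into V d n))
               | Inr n \<Rightarrow> Inr (c (g \<otimes> inv_into (carrier G) c n)))" for g and z :: "nat + nat"
  define act where "act g = restrict (f g) (elements Y)" for g
  have verts_Y: "verts Y = d ` V" and edges_Y: "edges Y = c ` carrier G"
    by (simp_all add: Y_def)
  have ends_Y: "ends Y (c g) = {d (g <# A), d (g <# B)}" if "g \<in> carrier G" for g
    using that c by (simp add: Y_def)
  have f_Inl: "f g (Inl (d C)) = Inl (d (g <# C))" if "C \<in> V" for g C
    using that d by (simp add: f_def)
  have f_Inr: "f g (Inr (c h)) = Inr (c (g \<otimes> h))" if "h \<in> carrier G" for g h
    using that c by (simp add: f_def)
  have elements_cases: "(\<exists>C \<in> V. z = Inl (d C)) \<or> (\<exists>h \<in> carrier G. z = Inr (c h))"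
    if "z \<in> elements Y" for z
    using that by (auto simp: elements_def verts_Y edges_Y)
  have action: "group_action G (elements Y) act"
    unfolding act_def
  proof (rule group_action_restrictI)
    fix g z assume "g \<in> carrier G" "z \<in> elements Y"
    then show "f g z \<in> elements Y"
      using elements_cases[of z] V_closed by (auto simp: f_Inl f_Inr verts_Y edges_Y)
  next
    fix z assume "z \<in> elements Y"
    then show "f \<one> z = z"
      using elements_cases[of z] V_subset by (auto simp: f_Inl f_Inr lcos_mult_one)
  next
    fix g h z assume "g \<in> carrier G" "h \<in> carrier G" "z \<in> elements Y"
    then show "f (g \<otimes> h) z = f g (f h z)"
      using elements_cases[of z] V_closed V_subset
      by (auto simp: f_Inl f_Inr lcos_m_assoc m_assoc)
  qed
  have act_coset: "act g (Inl (d C)) = Inl (d (g <# C))" if "C \<in> V" for g C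
    using that by (simp add: act_def f_Inl verts_Y)
  have act_elem: "act g (Inr (c h)) = Inr (c (g \<otimes> h))" if "h \<in> carrier G" for g h
    using that by (simp add: act_def f_Inr edges_Y)
  have multigraph: "multigraph Y"
  proof -
    have "d (g <# A) \<noteq> d (g <# B)" if "g \<in> carrier G" for g
      using inj_onD[OF d _ in_V[OF that]] coset_neq that by blast
    then show ?thesis
      using fin finite_V in_V
      by (auto simp: multigraph_def verts_Y edges_Y ends_Y)
  qed
  have "graph_morphism Y Y (act g)" if g: "g \<in> carrier G" for g
  proof -
    have "\<exists>e' \<in> edges Y. act g (Inr e) = Inr e' \<and> Inl ` ends Y e' = act g ` Inl ` ends Y e"
      if e: "e \<in> edges Y" for e
    proof -
      obtain h where h: "h \<in> carrier G" "e = c h"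
        using e by (auto simp: edges_Y)
      then show ?thesis
        using g in_V[OF h(1)]
        by (intro bexI[where x = "c (g \<otimes> h)"])
          (simp_all add: act_elem act_coset ends_Y edges_Y lcos_m_assoc A.subset B.subset)
    qed
    moreover have "act g (Inl v) \<in> Inl ` verts Y" if "v \<in> verts Y" for v
      using that V_closed[OF g] by (auto simp: verts_Y act_coset)
    ultimately show ?thesis
      by (simp add: graph_morphism_def)
  qed
  then interpret acting_group G Y act
    using action multigraph by (simp add: acting_group_iff graph_action_def)
  have connected: "connected_graph Y"
  proof -
    let ?R = "(adjacency Y)\<^sup>*"
    have sym: "(u, v) \<in> ?R \<Longrightarrow> (v, u) \<in> ?R" for u v
      by (rule symD[OF sym_rtrancl[OF adjacency_sym]])
    have AB: "(d (g <# A), d (g <# B)) \<in> ?R" if "g \<in> carrier G" for g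
      using that ends_Y[OF that] by (auto simp: adjacency_def edges_Y intro!: r_into_rtrancl)
    \<comment> \<open>For \<open>h\<close> in \<open>A\<close> the two cosets coincide; for
      \<open>h\<close> in \<open>B\<close> the path runs through the common coset
      \<open>g <# B\<close>.\<close>
    have step: "(d (g <# A), d ((g \<otimes> h) <# A)) \<in> ?R" if g: "g \<in> carrier G" and h: "h \<in> A \<union> B" for g h
    proof (cases "h \<in> A")
      case True
      then show ?thesis
        using g by (simp add: A.l_coset_mult_mem[OF is_group])
    next
      case False
      then have "h \<in> B" using h by simp
      then show ?thesis
        using AB[OF g] sym[OF AB[of "g \<otimes> h"]] g
        by (simp add: B.l_coset_mult_mem[OF is_group] B.mem_carrier)
    qed
    \<comment> \<open>The base point varies in the induction because a product
      \<open>h1 \<otimes> h2\<close> is walked as \<open>h1\<close> from \<open>g\<close>, then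
      \<open>h2\<close> from \<open>g \<otimes> h1\<close>.\<close>
    have reach: "(d (g <# A), d ((g \<otimes> h) <# A)) \<in> ?R"
      if "h \<in> generate G (A \<union> B)" "g \<in> carrier G" for g h
      using that
    proof (induction arbitrary: g)
      case one
      then show ?case by simp
    next
      case (incl h)
      then show ?case using step by simp
    next
      case (inv h)
      then show ?case using step[of g "inv h"] by auto
    next
      case (eng h1 h2)
      then have "h1 \<in> carrier G" "h2 \<in> carrier G"
        by (simp_all add: gen)
      then show ?case
        using eng.IH(1)[OF eng.prems] eng.IH(2)[of "g \<otimes> h1"] eng.prems by (simp add: m_assoc)
    qed
    have base: "(d (\<one> <# A), v) \<in> ?R" if v_verts: "v \<in> verts Y" for v
    proof -
      obtain g where g: "g \<in> carrier G" and v: "v = d (g <# A) \<or> v = d (g <# B)"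
        using v_verts by (auto simp: verts_Y V_def cosets)
      have "(d (\<one> <# A), d (g <# A)) \<in> ?R"
        using reach[of g \<one>] g by (simp add: gen)
      then show ?thesis
        using v AB[OF g] by auto
    qed
    moreover have "verts Y \<noteq> {}"
      by (auto simp: verts_Y V_def cosets)
    ultimately show ?thesis
      unfolding connected_graph_def by (meson rtrancl_trans sym)
  qed
  have "harmonic_action G Y act"
  proof (rule harmonic_actionI[OF connected])
    show "edges Y \<noteq> {}"
      by (auto simp: edges_Y)
  next
    fix g e assume g: "g \<in> carrier G" and "e \<in> edges Y" "eact g e = e"
    then obtain h where h: "h \<in> carrier G" "c (g \<otimes> h) = c h"
      by (auto simp: edges_Y eact_def act_elem)
    then have "g \<otimes> h = h"
      using inj_onD[OF c, of "g \<otimes> h" h] g by simp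
    then show "g = \<one>"
      using g h by simp
  next
    fix g e u assume g: "g \<in> carrier G" and e: "e \<in> edges Y" and u: "u \<in> ends Y e" "vact g u \<in> ends Y e"
    obtain h where h: "h \<in> carrier G" "e = c h"
      using e by (auto simp: edges_Y)
    have *: "vact g (d (h <# A)) = d ((g \<otimes> h) <# A)" "vact g (d (h <# B)) = d ((g \<otimes> h) <# B)"
      using g h in_V[OF h(1)]
      by (simp_all add: vact_def act_coset lcos_m_assoc A.subset B.subset)
    \<comment> \<open>The action never exchanges the two kinds of vertices, so an end that is moved
      to an end of the same edge stays put.\<close>
    have "d ((g \<otimes> h) <# A) \<noteq> d (h <# B)" "d ((g \<otimes> h) <# B) \<noteq> d (h <# A)"
      using inj_onD[OF d] in_V[OF h(1)] in_V[of "g \<otimes> h"] g h(1) coset_neq m_closed by metis+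
    then show "vact g u = u"
      using u h by (auto simp: ends_Y *)
  qed
  moreover have "int (order G) = 6 * (genus Y - 1)"
  proof -
    have "lcosets A \<inter> lcosets B = {}"
      using coset_neq by (auto simp: cosets)
    then have "card (verts Y) = card (lcosets A) + card (lcosets B)"
      using finite_V d by (simp add: verts_Y card_image V_def card_Un_disjoint)
    moreover have "card (edges Y) = order G"
      using c by (simp add: edges_Y card_image order_def)
    moreover have "card (lcosets A) * 2 = order G" "card (lcosets B) * 3 = order G"
      using l_lagrange[OF fin A(1)] l_lagrange[OF fin B(1)] A(2) B(2) by simp_all
    ultimately show ?thesis
      by (simp add: genus_def)
  qed
  \<comment> \<open>Dividing \<open>order G \<ge> 6\<close> by 6 gives the bound
    \<open>genus Y \<ge> 2\<close>.\<close>
  ultimately show ?thesis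
    using multigraph connected order fin is_group unfolding maximal_graph_group_def
    by (intro conjI exI[where x = Y] exI[where x = act]) auto
qed

lemma (in group) maximal_graph_group_if_ord:
  assumes fin: "finite (carrier G)" and "order G \<ge> 6" and xy: "x \<in> carrier G" "y \<in> carrier G"
    and ord: "ord x = 2" "ord y = 3" and gen: "generate G {x, y} = carrier G"
  shows "maximal_graph_group G"
proof (rule maximal_graph_group_if_generated[OF fin \<open>order G \<ge> 6\<close>])
  show "subgroup (generate G {x}) G" "subgroup (generate G {y}) G"
    using xy by (auto intro: generate_is_subgroup)
  show "card (generate G {x}) = 2" "card (generate G {y}) = 3"
    using xy ord generate_pow_card by simp_all
  have "generate G {x, y} \<subseteq> generate G (generate G {x} \<union> generate G {y})"
    by (rule mono_generate) (auto intro: generate.incl)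
  moreover have "generate G (generate G {x} \<union> generate G {y}) \<subseteq> carrier G"
    using xy generate_incl by (intro generate_incl) auto
  ultimately show "generate G (generate G {x} \<union> generate G {y}) = carrier G"
    using gen by auto
qed

section \<open>Freeness of harmonic actions\<close>

text \<open>By Lagrange, the order of a nontrivial element divides the prime \<open>card K\<close>,
  so the element generates \<open>K\<close>.\<close>

lemma (in group) subgroup_card_two_or_three_cyclic:
  assumes fin: "finite (carrier G)" and K: "subgroup K G" "card K = 2 \<or> card K = 3"
  obtains x where "x \<in> carrier G" "ord x = card K" "generate G {x} = K"
proof -
  interpret K: subgroup K G by (rule K(1))
  have "\<not> K \<subseteq> {\<one>}"
    using K(2) card_mono[of "{\<one>}" K] by auto
  then obtain x where x: "x \<in> K" "x \<noteq> \<one>" by blast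
  have incl: "generate G {x} \<subseteq> K"
    using x(1) by (intro generate_subgroup_incl K(1)) simp
  have card: "card (generate G {x}) = ord x"
    using generate_pow_card x(1) by simp
  have "subgroup (generate G {x}) (G\<lparr>carrier := K\<rparr>)"
    using x(1) incl K(1) by (intro subgroup_incl generate_is_subgroup) auto
  from group.lagrange[OF subgroup_imp_group[OF K(1)] this]
  have "card (rcosets\<^bsub>G\<lparr>carrier := K\<rparr>\<^esub> generate G {x}) * card (generate G {x}) = card K"
    by (simp add: order_def)
  then have "ord x dvd card K"
    unfolding card by (rule dvdI[OF HOL.sym, OF HOL.trans[OF mult.commute]])
  moreover have "ord x \<noteq> 1"
    using ord_eq_1[OF K.mem_carrier[OF x(1)]] x(2) by blast
  ultimately have "ord x = card K"
    using dvd_two_or_three K(2) by blast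
  moreover have "generate G {x} = K"
    using card_subset_eq[OF _ incl] fin finite_subset[OF K.subset] card \<open>ord x = card K\<close> by simp
  ultimately show ?thesis
    by (rule that[OF K.mem_carrier[OF x(1)]])
qed

context acting_group
begin

text \<open>When the whole group fixes \<open>v\<close> and \<open>e\<close>, the edge
  \<open>e\<close> is alone in its fibre at \<open>v\<close>. Harmonicity then makes every fibre at
  \<open>v\<close> a singleton, and an edge at \<open>v\<close> shares its fibre with all its
  translates.\<close>

lemma fixed_incident_edges:
  assumes harmonic: "harmonic_morphism Y (quotient_graph G Y act) (quotient_morphism G Y act)"
    and v: "v \<in> verts Y" "\<And>g. g \<in> carrier G \<Longrightarrow> vact g v = v"
    and e: "e \<in> incident_edges Y v" "\<And>g. g \<in> carrier G \<Longrightarrow> eact g e = e"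
    and e': "e' \<in> incident_edges Y v" and g: "g \<in> carrier G"
  shows "eact g e' = e'"
proof -
  let ?Q = "quotient_graph G Y act" and ?\<phi> = "quotient_morphism G Y act"
  have edges: "incident_edges Y v \<subseteq> edges Y"
    by (auto simp: incident_edges_def)
  \<comment> \<open>The orbit of \<open>v\<close> contains no other vertex, so the other end of an
    edge at \<open>v\<close> lies in another orbit.\<close>
  have nonvertical: "d \<in> nonvertical_edges G Y act" if d: "d \<in> incident_edges Y v" for d
  proof -
    obtain a b where ab: "ends Y d = {a, b}" "a \<noteq> b"
      using card_ends d edges by (meson card_2_iff subsetD)
    have "a = v \<or> b = v" "a \<in> verts Y" "b \<in> verts Y"
      using d ab ends_subset[of d] by (auto simp: incident_edges_def)
    then have "vertex_orbit G act a \<noteq> vertex_orbit G act b"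
      using vertex_orbit_eq_iff[of a b] vertex_orbit_eq_iff[of b a] v(2) ab(2) by metis
    then show ?thesis
      using d edges ab by (auto simp: nonvertical_edges_def)
  qed
  have \<phi>: "?\<phi> (Inr d) = Inr (edge_orbit G act d)" if "d \<in> incident_edges Y v" for d
    using nonvertical[OF that] by (simp add: quotient_morphism_def)
  have incident: "edge_orbit G act d \<in> incident_edges ?Q (vertex_orbit G act v)"
    if "d \<in> incident_edges Y v" for d
  proof -
    have "edge_orbit G act d \<in> edges ?Q"
      using nonvertical[OF that] by (simp add: quotient_graph_def)
    then show ?thesis
      using that ends_quotient_graph[of d] by (auto simp: incident_edges_def)
  qed
  have orbit_e: "{d \<in> incident_edges Y v. edge_orbit G act d = edge_orbit G act e} = {e}"
  proof -
    have "d = e" if "d \<in> incident_edges Y v" "edge_orbit G act d = edge_orbit G act e" for d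
      using edge_orbit_eq_iff[of d e] that e edges by (metis subsetD)
    then show ?thesis using e(1) by blast
  qed
  have "?\<phi> (Inl v) = Inl (vertex_orbit G act v)" "vertex_orbit G act v \<in> verts ?Q"
    using v(1) by (simp_all add: quotient_graph_def quotient_morphism_def)
  then have "card {d \<in> incident_edges Y v. ?\<phi> (Inr d) = Inr (edge_orbit G act e)} =
      card {d \<in> incident_edges Y v. ?\<phi> (Inr d) = Inr (edge_orbit G act e')}"
    using harmonic v(1) incident[OF e(1)] incident[OF e']
    unfolding harmonic_morphism_def by blast
  moreover have "{d \<in> incident_edges Y v. ?\<phi> (Inr d) = Inr (edge_orbit G act d')} =
      {d \<in> incident_edges Y v. edge_orbit G act d = edge_orbit G act d'}" for d'
    using \<phi> by (simp cong: conj_cong)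
  ultimately have "card {d \<in> incident_edges Y v. edge_orbit G act d = edge_orbit G act e'} = 1"
    by (simp add: orbit_e)
  then obtain d where d: "{d \<in> incident_edges Y v. edge_orbit G act d = edge_orbit G act e'} = {d}"
    by (rule card_1_singletonE)
  have "eact g e' \<in> incident_edges Y v" "e' \<in> edges Y"
    using g e' act_Inr(2,3)[of g e'] v(2)[OF g] imageI[of v "ends Y e'" "vact g"]
    by (simp_all add: incident_edges_def)
  then have "eact g e' \<in> {d}" "e' \<in> {d}"
    using e' edge_orbit_eact[OF g] unfolding d[symmetric] by auto
  then show ?thesis by simp
qed

lemma connected_induct [consumes 3, case_names base edge]:
  assumes "connected_graph Y" "w \<in> verts Y" "v \<in> verts Y"
    and base: "P v"
    and step: "\<And>e u w. \<lbrakk>e \<in> edges Y; ends Y e = {u, w}; P u\<rbrakk> \<Longrightarrow> P w"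
  shows "P w"
proof -
  have "(v, w) \<in> (adjacency Y)\<^sup>*"
    using assms by (auto simp: connected_graph_def)
  then show ?thesis
    by induction (use base step in \<open>auto simp: adjacency_def\<close>)
qed

text \<open>Harmonicity of the quotient by the cyclic group generated by \<open>g\<close> lets fixed
  edges spread: if a fixed vertex has one fixed edge, all its edges are fixed, hence so are their
  other ends. By connectedness \<open>g\<close> acts trivially, and faithfulness gives
  \<open>g = \<one>\<close>.\<close>

lemma harmonic_action_imp_free:
  assumes harmonic: "harmonic_action G Y act" and connected: "connected_graph Y"
    and g: "g \<in> carrier G" and e: "e \<in> edges Y" and v: "v \<in> ends Y e"
    and fixed_dart: "vact g v = v" "eact g e = e"
  shows "g = \<one>"
proof -
  define H where "H = generate G {g}"
  have H: "subgroup H G"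
    unfolding H_def using g by (intro generate_is_subgroup) simp
  interpret H: acting_group "G\<lparr>carrier := H\<rparr>" Y act
    by (rule subgroup_acting_group[OF H])
  have v_verts: "v \<in> verts Y"
    using e v ends_subset by auto
  have fix_v: "vact h v = v" and fix_e: "eact h e = e" if "h \<in> H" for h
  proof -
    have "{g} \<subseteq> stabilizer G act (Inl v)" "{g} \<subseteq> stabilizer G act (Inr e)"
      using g fixed_dart v_verts e by (auto simp: stabilizer_def act_Inl act_Inr)
    then have "H \<subseteq> stabilizer G act (Inl v)" "H \<subseteq> stabilizer G act (Inr e)"
      unfolding H_def using v_verts e by (auto intro!: generate_subgroup_incl stabilizer_subgroup del: subsetI)
    then show "vact h v = v" "eact h e = e"
      using that by (auto simp: stabilizer_def vact_def eact_def)
  qed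
  have incident: "eact h e' = e'"
    if "u \<in> verts Y" "\<And>h. h \<in> H \<Longrightarrow> vact h u = u" "d \<in> incident_edges Y u"
      "\<And>h. h \<in> H \<Longrightarrow> eact h d = d" "e' \<in> incident_edges Y u" "h \<in> H" for u d e' h
    using H.fixed_incident_edges[of u d e' h] that harmonic H
    by (simp add: harmonic_action_def H.vact_def H.eact_def vact_def eact_def)
  have fixed: "(\<forall>h \<in> H. vact h u = u) \<and> (\<forall>h \<in> H. \<forall>e' \<in> incident_edges Y u. eact h e' = e')"
    if "u \<in> verts Y" for u
    using connected that v_verts
  proof (induction rule: connected_induct)
    case base
    have "e \<in> incident_edges Y v"
      using e v by (simp add: incident_edges_def)
    then show ?case
      using incident[OF v_verts fix_v _ fix_e] fix_v by blast
  next
    case (edge d u w)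
    then have uw: "u \<noteq> w" "w \<in> verts Y"
      using card_ends[of d] ends_subset[of d] by auto
    have d_u: "d \<in> incident_edges Y u" and d_w: "d \<in> incident_edges Y w"
      using edge by (auto simp: incident_edges_def)
    have fix_d: "eact h d = d" if "h \<in> H" for h
      using edge.IH d_u that by blast
    \<comment> \<open>An element that fixes \<open>d\<close> and its end \<open>u\<close> must fix
      the other end.\<close>
    have fix_w: "vact h w = w" if "h \<in> H" for h
    proof -
      have "{u, vact h w} = {u, w}"
        using act_Inr(3)[OF _ edge.hyps(1), of h] subgroup.mem_carrier[OF H that] fix_d[OF that]
          edge.hyps(2) edge.IH that by simp
      then show ?thesis
        using uw(1) by (metis doubleton_eq_iff)
    qed
    show ?case
      using incident[OF uw(2) fix_w d_w fix_d] fix_w by blast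
  qed
  have g_H: "g \<in> H"
    by (simp add: H_def generate.incl)
  have "act g = act \<one>"
  proof (rule extensionalityI)
    show "act g \<in> extensional (elements Y)" "act \<one> \<in> extensional (elements Y)"
      using bij_prop0 g by (auto simp: Bij_def)
    fix z assume z: "z \<in> elements Y"
    then consider u where "z = Inl u" "u \<in> verts Y" | d where "z = Inr d" "d \<in> edges Y"
      by (auto simp: elements_def)
    then show "act g z = act \<one> z"
    proof cases
      case 1
      then show ?thesis using fixed g_H g by (simp add: act_Inl)
    next
      case 2
      then obtain u where u: "u \<in> ends Y d"
        using card_ends[of d] by fastforce
      then have "d \<in> incident_edges Y u" "u \<in> verts Y"
        using 2 ends_subset[of d] by (auto simp: incident_edges_def)
      then have "eact g d = d"
        using fixed g_H by blast
      then show ?thesis using 2 g by (simp add: act_Inr)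
    qed
  qed
  moreover have "inj_on act (carrier G)"
    using harmonic faithful_action.faithful
    unfolding harmonic_action_def faithful_graph_action_def by blast
  ultimately show ?thesis
    using g inj_onD by fastforce
qed

end

section \<open>Counting darts\<close>

text \<open>Two denominators of at least 3 give at most 2/3, which is below 5/6. Hence one of them
  is 2, and the equation determines the other.\<close>

lemma two_unit_fractions:
  fixes a b :: nat
  assumes "a \<ge> 2" "b \<ge> 2" and eq: "1 / real a + 1 / real b = 5 / 6"
  shows "a = 2 \<and> b = 3 \<or> a = 3 \<and> b = 2"
proof -
  have eq': "6 * real b + 6 * real a = 5 * (real a * real b)"
    using assms by (simp add: field_simps)
  have "a = 2 \<or> b = 2"
  proof (rule ccontr)
    assume "\<not> (a = 2 \<or> b = 2)"
    then have "real a \<ge> 3" "real b \<ge> 3" using assms by linarith+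
    then have "1 / real a \<le> 1 / 3" "1 / real b \<le> 1 / 3"
      by (simp_all add: divide_simps)
    with eq show False by linarith
  qed
  with eq' show ?thesis by auto
qed

text \<open>Each nontrivial stabilizer contributes at least 3 and less than 6 to the sum, so there
  are at most two of them, and their number determines \<open>m\<close>.\<close>

lemma orbifold_equation:
  fixes s :: "'t \<Rightarrow> nat" and m :: nat
  assumes fin: "finite T" and pos: "\<And>t. t \<in> T \<Longrightarrow> s t > 0"
    and eq: "3 * real m + (\<Sum>t\<in>T. 6 * (1 - 1 / real (s t))) = 7"
  shows "(m = 0 \<and> (\<exists>a b. {t \<in> T. s t \<noteq> 1} = {a, b} \<and> s a = 2 \<and> s b = 3)) \<or>
    (m = 1 \<and> (\<exists>b. {t \<in> T. s t \<noteq> 1} = {b} \<and> s b = 3))"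
proof -
  define N where "N = {t \<in> T. s t \<noteq> 1}"
  define w where "w t = 6 * (1 - 1 / real (s t))" for t
  have N: "finite N" "N \<subseteq> T"
    using fin by (auto simp: N_def)
  have sum: "sum w N = 7 - 3 * real m"
  proof -
    have "sum w N = sum w T"
      using fin by (intro sum.mono_neutral_left) (auto simp: N_def w_def)
    then show ?thesis using eq by (simp add: w_def)
  qed
  have ge2: "s t \<ge> 2" if "t \<in> N" for t
    using that pos[of t] by (auto simp: N_def)
  have lower: "w t \<ge> 3" if "t \<in> N" for t
    using ge2[OF that] by (simp add: w_def field_simps)
  have upper: "w t < 6" if "t \<in> N" for t
    using ge2[OF that] by (simp add: w_def field_simps)
  have "3 * real (card N) \<le> sum w N"
    using sum_mono[of N "\<lambda>_. 3" w] lower by simp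
  then have "3 * real (card N) \<le> 7"
    using sum by linarith
  then have "card N \<le> 2" by linarith
  then consider "card N = 0" | "card N = 1" | "card N = 2" by linarith
  then show ?thesis
  proof cases
    case 1
    \<comment> \<open>Without nontrivial stabilizers there is no solution, as 7 is not a multiple of
      3.\<close>
    then have "3 * real m = 7" using N sum by simp
    then have "real (3 * m) = real 7" by simp
    then have "3 * m = 7" by (simp only: of_nat_eq_iff)
    then show ?thesis by presburger
  next
    case 2
    then obtain b where b: "N = {b}" by (rule card_1_singletonE)
    have w: "w b = 7 - 3 * real m" using sum b by simp
    \<comment> \<open>Of the values 7, 4, 1 of \<open>7 - 3 * m\<close> only 4 lies between 3 and 6,
      and a contribution of 4 means a stabilizer of order 3.\<close>
    have "real m < 2" "real m > 0"
      using w lower[of b] upper[of b] b by auto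
    then have m: "m = 1" by linarith
    have "s b = 3"
      using w m ge2[of b] b by (simp add: w_def field_simps)
    then show ?thesis using b m by (auto simp: N_def)
  next
    case 3
    then obtain a b where ab: "N = {a, b}" "a \<noteq> b"
      by (meson card_2_iff)
    have w: "w a + w b = 7 - 3 * real m" using sum ab by simp
    \<comment> \<open>Two contributions total at least 6, and \<open>m \<ge> 1\<close> would leave
      at most 4.\<close>
    have m: "m = 0"
      using w lower[of a] lower[of b] ab by auto
    have "1 / real (s a) + 1 / real (s b) = 5 / 6"
      using w m by (simp add: w_def algebra_simps)
    then have "s a = 2 \<and> s b = 3 \<or> s a = 3 \<and> s b = 2"
      using two_unit_fractions ge2 ab by simp
    then show ?thesis
      using ab m unfolding N_def by (metis insert_commute)
  qed
qed

text \<open>The assumption \<open>free\<close> concerns an edge together with one of its ends, so an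
  element may still reverse an edge. It is the conclusion of
  \<open>harmonic_action_imp_free\<close>.\<close>

locale free_acting_group = acting_group G Y act
  for G (structure) and Y :: "('v, 'e) mgraph" and act +
  assumes finite_carrier: "finite (carrier G)" and connected: "connected_graph Y"
    and free: "\<lbrakk>g \<in> carrier G; e \<in> edges Y; v \<in> ends Y e; vact g v = v; eact g e = e\<rbrakk> \<Longrightarrow> g = \<one>"
begin

text \<open>Oriented edges. An element that reverses an edge fixes the edge but neither of its
  darts, so on darts the action is free.\<close>

definition darts where
  "darts = {(u, e, w). e \<in> edges Y \<and> ends Y e = {u, w}}"

definition dact where
  "dact g d = (case d of (u, e, w) \<Rightarrow> (vact g u, eact g e, vact g w))"

lemma dact_simps [simp]: "dact g (u, e, w) = (vact g u, eact g e, vact g w)"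
  by (simp add: dact_def)

lemma darts_verts: "(u, e, w) \<in> darts \<Longrightarrow> u \<in> verts Y \<and> e \<in> edges Y \<and> w \<in> verts Y"
  using ends_subset by (auto simp: darts_def)

lemma darts_sym: "(u, e, w) \<in> darts \<longleftrightarrow> (w, e, u) \<in> darts"
  by (auto simp: darts_def insert_commute)

lemma dact_closed: "\<lbrakk>g \<in> carrier G; d \<in> darts\<rbrakk> \<Longrightarrow> dact g d \<in> darts"
  by (auto simp: darts_def act_Inr(2,3))

lemma dact_mult:
  assumes "g \<in> carrier G" "h \<in> carrier G" "d \<in> darts"
  shows "dact (g \<otimes> h) d = dact g (dact h d)"
proof -
  obtain u e w where "d = (u, e, w)" by (cases d)
  then show ?thesis
    using assms darts_verts[of u e w] by (simp add: vact_mult eact_mult)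
qed

lemma dact_one:
  assumes "d \<in> darts" shows "dact \<one> d = d"
proof -
  obtain u e w where "d = (u, e, w)" by (cases d)
  then show ?thesis
    using assms darts_verts[of u e w] by simp
qed

lemma dact_free:
  assumes "g \<in> carrier G" "d \<in> darts" "dact g d = d"
  shows "g = \<one>"
proof -
  obtain u e w where "d = (u, e, w)" by (cases d)
  then show ?thesis
    using assms free[of g e u] by (simp add: darts_def)
qed

lemma dact_inj:
  assumes "g \<in> carrier G" "h \<in> carrier G" "d \<in> darts" "dact g d = dact h d"
  shows "g = h"
proof -
  have "dact (inv h \<otimes> g) d = dact (inv h) (dact h d)"
    using assms by (simp add: dact_mult)
  also have "\<dots> = dact (inv h \<otimes> h) d"
    using assms by (simp only: dact_mult inv_closed)
  finally have "inv h \<otimes> g = \<one>"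
    using assms by (intro dact_free[of _ d]) (simp_all add: dact_one)
  then show ?thesis
    using assms(1,2) by (metis inv_equality inv_inv inv_closed)
qed

lemma finite_darts: "finite darts"
  by (rule finite_subset[of _ "verts Y \<times> edges Y \<times> verts Y"])
    (use darts_verts finite_graph in auto)

lemma card_darts: "card darts = 2 * card (edges Y)"
proof -
  let ?D = "\<lambda>e. {(u, e', w). e' = e \<and> ends Y e = {u, w}}"
  have card_D: "card (?D e) = 2" if e: "e \<in> edges Y" for e
  proof -
    obtain a b where ab: "ends Y e = {a, b}" "a \<noteq> b"
      using card_ends[OF e] by (meson card_2_iff)
    then have "?D e = {(a, e, b), (b, e, a)}"
      by (auto simp: doubleton_eq_iff)
    then show ?thesis using ab(2) by simp
  qed
  have "darts = (\<Union>e\<in>edges Y. ?D e)"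
    by (auto simp: darts_def)
  also have "card \<dots> = (\<Sum>e\<in>edges Y. card (?D e))"
  proof (intro card_UN_disjoint ballI impI finite_graph)
    fix e assume "e \<in> edges Y"
    then show "finite (?D e)"
      using card_D card.infinite by (metis zero_neq_numeral)
  qed auto
  also have "\<dots> = 2 * card (edges Y)"
    using card_D by simp
  finally show ?thesis .
qed

section \<open>Orbits of darts\<close>

definition dart_orbit where "dart_orbit d = (\<lambda>g. dact g d) ` carrier G"

lemma card_dart_orbit:
  assumes "d \<in> darts"
  shows "card (dart_orbit d) = order G"
proof -
  have "inj_on (\<lambda>g. dact g d) (carrier G)"
    using assms dact_inj by (intro inj_onI) blast
  then show ?thesis
    by (simp add: dart_orbit_def order_def card_image)
qed

lemma dart_orbit_subset: "d \<in> darts \<Longrightarrow> dart_orbit d \<subseteq> darts"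
  unfolding dart_orbit_def using dact_closed by blast

lemma self_in_dart_orbit: "d \<in> darts \<Longrightarrow> d \<in> dart_orbit d"
  unfolding dart_orbit_def using dact_one[of d] by (metis imageI one_closed)

lemma dart_orbit_dact:
  assumes "d \<in> darts" "g \<in> carrier G"
  shows "dart_orbit (dact g d) = dart_orbit d"
proof (intro equalityI subsetI)
  fix x assume "x \<in> dart_orbit (dact g d)"
  then obtain h where "h \<in> carrier G" "x = dact (h \<otimes> g) d"
    using assms by (auto simp: dart_orbit_def dact_mult)
  then show "x \<in> dart_orbit d"
    using assms by (auto simp: dart_orbit_def)
next
  fix x assume "x \<in> dart_orbit d"
  then obtain h where h: "h \<in> carrier G" "x = dact h d"
    by (auto simp: dart_orbit_def)
  have "x = dact (h \<otimes> inv g) (dact g d)"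
    using assms h by (simp add: dact_mult[symmetric] m_assoc dact_closed)
  then show "x \<in> dart_orbit (dact g d)"
    using assms h by (auto simp: dart_orbit_def)
qed

lemma dart_orbit_eq:
  assumes "d \<in> darts" "x \<in> dart_orbit d"
  shows "dart_orbit x = dart_orbit d"
proof -
  obtain g where "g \<in> carrier G" "x = dact g d"
    using assms(2) by (auto simp: dart_orbit_def)
  then show ?thesis
    using dart_orbit_dact assms(1) by simp
qed

text \<open>An invariant set is a disjoint union of free orbits, each with \<open>order G\<close>
  members.\<close>

lemma order_dvd_card_invariant:
  assumes M: "M \<subseteq> darts" and invariant: "\<And>d. d \<in> M \<Longrightarrow> dart_orbit d \<subseteq> M"
  shows "order G dvd card M"
proof -
  have M_eq: "M = \<Union> (dart_orbit ` M)"
    using M invariant self_in_dart_orbit by blast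
  have "order G dvd card (\<Union> (dart_orbit ` M))"
  proof (rule dvd_partition)
    show "finite (\<Union> (dart_orbit ` M))"
      using M_eq M finite_darts finite_subset by metis
    show "\<forall>c \<in> dart_orbit ` M. order G dvd card c"
      using M card_dart_orbit by auto
    show "\<forall>c1\<in>dart_orbit ` M. \<forall>c2\<in>dart_orbit ` M. c1 \<noteq> c2 \<longrightarrow> c1 \<inter> c2 = {}"
    proof (intro ballI impI)
      fix c1 c2 assume "c1 \<in> dart_orbit ` M" "c2 \<in> dart_orbit ` M" "c1 \<noteq> c2"
      then obtain d1 d2 where d: "d1 \<in> darts" "d2 \<in> darts" "c1 = dart_orbit d1" "c2 = dart_orbit d2"
        using M by blast
      show "c1 \<inter> c2 = {}"
      proof (rule ccontr)
        assume "c1 \<inter> c2 \<noteq> {}"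
        then obtain x where "x \<in> dart_orbit d1" "x \<in> dart_orbit d2"
          using d by blast
        then have "c1 = c2"
          using d dart_orbit_eq by metis
        with \<open>c1 \<noteq> c2\<close> show False by simp
      qed
    qed
  qed
  then show ?thesis by (simp only: M_eq[symmetric])
qed

end

section \<open>Fundamental trees\<close>

context free_acting_group
begin

text \<open>\<open>S\<close> holds both orientations of each tree edge; being a tree is encoded by the last conjunct
  only, which is all that the count needs.\<close>

definition fundamental_tree :: "'v set \<Rightarrow> ('v \<times> 'e \<times> 'v) set \<Rightarrow> bool" where
  "fundamental_tree T S \<longleftrightarrow>
     T \<subseteq> verts Y \<and> T \<noteq> {} \<and>
     (\<forall>t \<in> T. \<forall>t' \<in> T. \<forall>g \<in> carrier G. vact g t = t' \<longrightarrow> t = t') \<and>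
     S \<subseteq> darts \<and> (\<forall>u e w. (u, e, w) \<in> S \<longrightarrow> u \<in> T \<and> w \<in> T \<and> (w, e, u) \<in> S) \<and>
     (\<forall>u e e' w. (u, e, w) \<in> S \<longrightarrow> (u, e', w) \<in> S \<longrightarrow> e = e') \<and>
     card S + 2 = 2 * card T"

lemma fundamental_treeD:
  assumes "fundamental_tree T S"
  shows "T \<subseteq> verts Y" "T \<noteq> {}" "S \<subseteq> darts" "card S + 2 = 2 * card T"
    and "\<And>t t' g. \<lbrakk>t \<in> T; t' \<in> T; g \<in> carrier G; vact g t = t'\<rbrakk> \<Longrightarrow> t = t'"
    and "\<And>u e w. (u, e, w) \<in> S \<Longrightarrow> u \<in> T \<and> w \<in> T \<and> (w, e, u) \<in> S"
    and "\<And>u e e' w. \<lbrakk>(u, e, w) \<in> S; (u, e', w) \<in> S\<rbrakk> \<Longrightarrow> e = e'"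
  using assms unfolding fundamental_tree_def by (simp_all, blast+)

text \<open>The new vertex raises \<open>card T\<close> by 1 and its two darts raise
  \<open>card S\<close> by 2, so the tree count persists. As \<open>w\<close> lies outside
  \<open>T\<close>, no dart of \<open>S\<close> touches it, and no parallel edge arises.\<close>

lemma fundamental_tree_insert:
  assumes tree: "fundamental_tree T S" and t: "t \<in> T" and d: "(t, e, w) \<in> darts"
    and new: "\<And>g t'. \<lbrakk>g \<in> carrier G; t' \<in> T\<rbrakk> \<Longrightarrow> vact g t' \<noteq> w"
  shows "fundamental_tree (insert w T) (insert (t, e, w) (insert (w, e, t) S))"
proof -
  note tree = fundamental_treeD[OF tree]
  have w: "w \<in> verts Y" "w \<notin> T"
    using darts_verts[OF d] new[of \<one> w] tree(1) by auto
  have "vact g w \<noteq> t'" if "g \<in> carrier G" "t' \<in> T" for g t'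
    using new[of "inv g" t'] vact_inv[of g w] that w(1) by auto
  then have inequivalent: "\<forall>t \<in> insert w T. \<forall>t' \<in> insert w T. \<forall>g \<in> carrier G. vact g t = t' \<longrightarrow> t = t'"
    using new tree(5) by blast
  have not_S: "(u, e', w) \<notin> S" "(w, e', u) \<notin> S" for u e'
    using tree(6) w(2) by blast+
  have "t \<noteq> w"
    using t w(2) by auto
  have "finite S" "finite T"
    using finite_subset[OF tree(3) finite_darts] finite_subset[OF tree(1) finite_graph(1)] .
  then have "card (insert (t, e, w) (insert (w, e, t) S)) + 2 = 2 * card (insert w T)"
    using tree(4) w(2) \<open>t \<noteq> w\<close> not_S by (simp add: card_insert_if)
  moreover have "\<forall>u e1 e2 v. (u, e1, v) \<in> insert (t, e, w) (insert (w, e, t) S) \<longrightarrow>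
      (u, e2, v) \<in> insert (t, e, w) (insert (w, e, t) S) \<longrightarrow> e1 = e2"
    using tree(7) not_S by auto
  moreover have "insert (t, e, w) (insert (w, e, t) S) \<subseteq> darts"
    using d darts_sym tree(3) by blast
  moreover have "\<forall>u f v. (u, f, v) \<in> insert (t, e, w) (insert (w, e, t) S) \<longrightarrow>
      u \<in> insert w T \<and> v \<in> insert w T \<and> (v, f, u) \<in> insert (t, e, w) (insert (w, e, t) S)"
    using tree(6) t by blast
  moreover have "insert w T \<subseteq> verts Y"
    using tree(1) w(1) by blast
  ultimately show ?thesis
    unfolding fundamental_tree_def using inequivalent by (intro conjI) (assumption | rule insert_not_empty)+
qed

text \<open>A tree with the greatest number of vertices meets every orbit. Otherwise a path from the
  tree leaves the orbits already met along some edge, and a translate of that edge starts in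
  \<open>T\<close> and enlarges the tree.\<close>

lemma obtain_fundamental_tree:
  obtains T S where "fundamental_tree T S"
    and "\<And>v. v \<in> verts Y \<Longrightarrow> \<exists>t \<in> T. \<exists>g \<in> carrier G. v = vact g t"
proof -
  obtain v0 where "v0 \<in> verts Y"
    using connected by (auto simp: connected_graph_def)
  then have "fundamental_tree {v0} {}"
    by (simp add: fundamental_tree_def)
  moreover have "card T \<le> card (verts Y)" if "fundamental_tree T S" for T S
    using fundamental_treeD(1)[OF that] finite_graph(1) by (rule card_mono[rotated])
  ultimately have "\<exists>T. (\<exists>S. fundamental_tree T S) \<and>
      (\<forall>T'. (\<exists>S'. fundamental_tree T' S') \<longrightarrow> card T' \<le> card T)"
    by (intro ex_has_greatest_nat[of _ "{v0}" card "Suc (card (verts Y))"])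
      (auto simp: le_imp_less_Suc)
  then obtain T S where tree: "fundamental_tree T S"
    and maximal: "\<And>T' S'. fundamental_tree T' S' \<Longrightarrow> card T' \<le> card T" by blast
  have finite_T: "finite T"
    using finite_subset[OF fundamental_treeD(1)[OF tree] finite_graph(1)] .
  obtain t0 where t0: "t0 \<in> T"
    using fundamental_treeD(2)[OF tree] by auto
  have "\<exists>t \<in> T. \<exists>g \<in> carrier G. v = vact g t" if "v \<in> verts Y" for v
  proof -
    have "t0 \<in> verts Y"
      using t0 fundamental_treeD(1)[OF tree] by auto
    with connected that show ?thesis
    proof (induction rule: connected_induct)
      case base
      show ?case
        using t0 \<open>t0 \<in> verts Y\<close> by (intro bexI[of _ t0] bexI[of _ \<one>]) auto
    next
      case (edge e u w)
      then obtain t g where t: "t \<in> T" "g \<in> carrier G" "u = vact g t" by blast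
      have t_verts: "t \<in> verts Y"
        using t(1) fundamental_treeD(1)[OF tree] by auto
      have "(u, e, w) \<in> darts"
        using edge by (simp add: darts_def)
      \<comment> \<open>Pulling the edge back by \<open>inv g\<close> moves its end \<open>u\<close>
        to \<open>t\<close>.\<close>
      then have d: "(t, eact (inv g) e, vact (inv g) w) \<in> darts" and w: "w \<in> verts Y"
        using dact_closed[of "inv g" "(u, e, w)"] darts_verts[of u e w] t t_verts by simp_all
      show ?case
      proof (rule ccontr)
        assume contra: "\<not> ?case"
        have new: "vact h t' \<noteq> vact (inv g) w" if h: "h \<in> carrier G" "t' \<in> T" for h t'
        proof
          assume "vact h t' = vact (inv g) w"
          then have "vact (g \<otimes> h) t' = w"
            using h t(2) w fundamental_treeD(1)[OF tree] vact_inv[of "inv g" w]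
            by (simp add: vact_mult subset_iff)
          with contra h t(2) show False by blast
        qed
        from maximal[OF fundamental_tree_insert[OF tree t(1) d new]]
        have "vact (inv g) w \<in> T"
          using finite_T by (auto simp: card_insert_if split: if_splits)
        then show False
          using new[of \<one> "vact (inv g) w"] fundamental_treeD(1)[OF tree] by auto
      qed
    qed
  qed
  with tree show ?thesis by (rule that)
qed

section \<open>Orbit counts over a fundamental tree\<close>

lemma stabilizer_Inl:
  "v \<in> verts Y \<Longrightarrow> stabilizer G act (Inl v) = {g \<in> carrier G. vact g v = v}"
  by (auto simp: stabilizer_def act_Inl)

text \<open>Equivalent vertices of \<open>T\<close> are equal, so equivalent darts of
  \<open>S\<close> have the same ends, and \<open>S\<close> has no parallel edges.\<close>

lemma fundamental_tree_dart_unique: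
  assumes "fundamental_tree T S" "d \<in> S" "d' \<in> S" "g \<in> carrier G" "dact g d = d'"
  shows "d = d'"
proof -
  note tree = fundamental_treeD[OF assms(1)]
  obtain u e w where d: "d = (u, e, w)" by (cases d)
  obtain u' e' w' where d': "d' = (u', e', w')" by (cases d')
  have "u = u'" "w = w'"
    using assms(2-5) d d' tree(5)[of _ _ g] tree(6) by auto
  then show ?thesis
    using assms(2,3) d d' tree(7) by simp
qed

text \<open>Each dart of the tree has a free orbit, and by
  \<open>fundamental_tree_dart_unique\<close> distinct darts have disjoint orbits.\<close>

lemma card_tree_dart_orbits:
  assumes tree: "fundamental_tree T S"
  shows "card (\<Union> (dart_orbit ` S)) = card S * order G"
proof -
  note S = fundamental_treeD(3)[OF tree]
  have "card (\<Union> (dart_orbit ` S)) = (\<Sum>d\<in>S. card (dart_orbit d))"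
  proof (intro card_UN_disjoint ballI impI)
    show "finite S"
      using finite_subset[OF S finite_darts] .
    show "finite (dart_orbit d)" for d
      using finite_carrier by (simp add: dart_orbit_def)
    fix d d' assume d: "d \<in> S" "d' \<in> S" "d \<noteq> d'"
    show "dart_orbit d \<inter> dart_orbit d' = {}"
    proof (rule ccontr)
      assume "dart_orbit d \<inter> dart_orbit d' \<noteq> {}"
      then have "dart_orbit d = dart_orbit d'"
        using dart_orbit_eq d S by blast
      then obtain g where "g \<in> carrier G" "d' = dact g d"
        using self_in_dart_orbit[of d'] d S by (auto simp: dart_orbit_def)
      then show False
        using fundamental_tree_dart_unique[OF tree] d by metis
    qed
  qed
  also have "\<dots> = card S * order G"
    using sum.cong[OF HOL.refl, of S "\<lambda>d. card (dart_orbit d)" "\<lambda>d. order G"]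
      card_dart_orbit subsetD[OF S] by simp
  finally show ?thesis .
qed

text \<open>The vertices of \<open>T\<close> represent each vertex orbit exactly once, and the
  orbit-stabilizer theorem gives the size of each orbit.\<close>

lemma card_verts_eq_sum:
  assumes tree: "fundamental_tree T S"
    and spanning: "\<And>v. v \<in> verts Y \<Longrightarrow> \<exists>t \<in> T. \<exists>g \<in> carrier G. v = vact g t"
  shows "real (card (verts Y)) = (\<Sum>t\<in>T. real (order G) / real (card (stabilizer G act (Inl t))))"
proof -
  note T = fundamental_treeD(1)[OF tree]
  let ?O = "\<lambda>t. (\<lambda>g. vact g t) ` carrier G"
  have "verts Y = (\<Union>t\<in>T. ?O t)"
  proof (intro equalityI subsetI)
    fix v assume "v \<in> verts Y"
    then show "v \<in> (\<Union>t\<in>T. ?O t)"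
      using spanning by blast
  qed (use act_Inl(2) T in auto)
  also have "card \<dots> = (\<Sum>t\<in>T. card (?O t))"
  proof (intro card_UN_disjoint ballI impI)
    show "finite T"
      using finite_subset[OF T finite_graph(1)] .
    show "finite (?O t)" for t
      using finite_carrier by simp
    fix t t' assume t: "t \<in> T" "t' \<in> T" "t \<noteq> t'"
    show "?O t \<inter> ?O t' = {}"
    proof (rule ccontr)
      assume "?O t \<inter> ?O t' \<noteq> {}"
      then obtain g h where gh: "g \<in> carrier G" "h \<in> carrier G" "vact g t = vact h t'" by auto
      then have "vact (inv h \<otimes> g) t = t'"
        using t T by (simp add: vact_mult subset_iff)
      then show False
        using fundamental_treeD(5)[OF tree t(1,2), of "inv h \<otimes> g"] gh t(3) by simp
    qed
  qed
  also have "real \<dots> = (\<Sum>t\<in>T. real (order G) / real (card (stabilizer G act (Inl t))))"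
    unfolding of_nat_sum
  proof (rule sum.cong[OF HOL.refl])
    fix t assume "t \<in> T"
    then have t: "t \<in> verts Y" using T by auto
    have "orbit G act (Inl t) = Inl ` ?O t"
      using t act_Inl(1) by (force simp: orbit_def)
    then have "card (orbit G act (Inl t)) = card (?O t)"
      by (simp add: card_image)
    then have "real (card (?O t)) * real (card (stabilizer G act (Inl t))) = real (order G)"
      using orbit_stabilizer_theorem[of "Inl t"] t by (metis Inl_elements of_nat_mult)
    moreover have "real (order G) \<noteq> 0"
      using finite_carrier order_gt_0_iff_finite by simp
    ultimately show "real (card (?O t)) = real (order G) / real (card (stabilizer G act (Inl t)))"
      by (metis eq_divide_eq mult_zero_right)
  qed
  finally show ?thesis .
qed

text \<open>The translates of \<open>T\<close> by \<open>H\<close> are closed under passing to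
  neighbours, so they cover the connected graph. If \<open>vact g t0 = vact h t\<close> with
  \<open>h\<close> in \<open>H\<close>, then \<open>t0 = t\<close> and
  \<open>inv h \<otimes> g\<close> stabilizes \<open>t\<close>, which puts \<open>g\<close> in
  \<open>H\<close>.\<close>

lemma generated_by_tree:
  assumes tree: "fundamental_tree T S" and H: "subgroup H G"
    and stabilizers: "\<And>t. t \<in> T \<Longrightarrow> stabilizer G act (Inl t) \<subseteq> H"
    and others: "\<And>u e w. \<lbrakk>(u, e, w) \<in> darts - \<Union> (dart_orbit ` S); u \<in> T\<rbrakk>
      \<Longrightarrow> \<exists>t \<in> T. \<exists>h \<in> H. w = vact h t"
  shows "H = carrier G"
proof -
  note T = fundamental_treeD(1)[OF tree]
  interpret H: subgroup H G by (rule H)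
  have stab: "g \<in> H" if "t \<in> T" "g \<in> carrier G" "vact g t = t" for g t
    using stabilizers[OF that(1)] stabilizer_Inl[of t] that T by auto
  \<comment> \<open>If a translate of a tree dart starts in \<open>T\<close>, it starts at the same
    vertex as the original, so the translating element stabilizes that vertex and lies in
    \<open>H\<close>.\<close>
  have neighbour: "\<exists>t \<in> T. \<exists>h \<in> H. w = vact h t" if d: "(u, e, w) \<in> darts" "u \<in> T" for u e w
  proof (cases "(u, e, w) \<in> \<Union> (dart_orbit ` S)")
    case True
    then obtain t f t' g where t: "(t, f, t') \<in> S" "g \<in> carrier G" "(u, e, w) = dact g (t, f, t')"
      by (auto simp: dart_orbit_def)
    have "t \<in> T" "t' \<in> T"
      using fundamental_treeD(6)[OF tree t(1)] by auto
    moreover have "t = u"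
      using fundamental_treeD(5)[OF tree \<open>t \<in> T\<close> d(2) t(2)] t(3) by simp
    ultimately show ?thesis
      using stab[of t g] t by auto
  next
    case False
    then show ?thesis
      using others d by blast
  qed
  obtain t0 where t0: "t0 \<in> T" "t0 \<in> verts Y"
    using fundamental_treeD(2)[OF tree] T by auto
  have reach: "\<exists>t \<in> T. \<exists>h \<in> H. v = vact h t" if "v \<in> verts Y" for v
    using connected that t0(2)
  proof (induction rule: connected_induct)
    case base
    show ?case
      using t0 by (intro bexI[of _ t0] bexI[of _ \<one>]) auto
  next
    case (edge e u w)
    then obtain t h where t: "t \<in> T" "h \<in> H" "u = vact h t" by blast
    have h: "h \<in> carrier G" and t_verts: "t \<in> verts Y"
      using t T by auto
    have uw: "(u, e, w) \<in> darts" "w \<in> verts Y"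
      using edge ends_subset[of e] by (auto simp: darts_def)
    \<comment> \<open>Pulled back by \<open>inv h\<close>, the edge starts in \<open>T\<close>,
      where \<open>neighbour\<close> applies.\<close>
    then have "(t, eact (inv h) e, vact (inv h) w) \<in> darts"
      using dact_closed[of "inv h" "(u, e, w)"] t(3) h t_verts by simp
    then obtain t' k where t': "t' \<in> T" "k \<in> H" "vact (inv h) w = vact k t'"
      using neighbour t(1) by blast
    have "w = vact (inv (inv h)) (vact (inv h) w)"
      using vact_inv[of "inv h" w] h uw(2) by simp
    then have "w = vact (h \<otimes> k) t'"
      using t' h T by (simp add: vact_mult subset_iff)
    then show ?case
      using t' t(2) by blast
  qed
  have "carrier G \<subseteq> H"
  proof
    fix g assume g: "g \<in> carrier G"
    obtain t h where t: "t \<in> T" "h \<in> H" "vact g t0 = vact h t"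
      using reach[of "vact g t0"] act_Inl(2)[OF g t0(2)] by blast
    have h: "h \<in> carrier G" "t \<in> verts Y"
      using t T by auto
    have *: "vact (inv h \<otimes> g) t0 = t"
      using t h g t0 by (simp add: vact_mult)
    have "t0 = t"
      by (rule fundamental_treeD(5)[OF tree t0(1) t(1) _ *]) (use g h in simp)
    then have "inv h \<otimes> g \<in> H"
      using stab[OF t(1), of "inv h \<otimes> g"] * g h by simp
    then have "h \<otimes> (inv h \<otimes> g) \<in> H"
      using t(2) by simp
    then show "g \<in> H"
      using g h by (simp add: m_assoc[symmetric])
  qed
  then show ?thesis
    using H.subset by blast
qed

text \<open>Counting darts and vertices by orbits turns the hypothesis into the orbifold equation;
  each of its two solutions supplies elements to which \<open>generated_by_tree\<close>
  applies.\<close>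

lemma exists_generators:
  assumes order: "int (order G) = 6 * (genus Y - 1)"
  shows "\<exists>x \<in> carrier G. \<exists>y \<in> carrier G. ord x = 2 \<and> ord y = 3 \<and> generate G {x, y} = carrier G"
proof -
  obtain T S where tree: "fundamental_tree T S"
    and spanning: "\<And>v. v \<in> verts Y \<Longrightarrow> \<exists>t \<in> T. \<exists>g \<in> carrier G. v = vact g t"
    using obtain_fundamental_tree by blast
  note treeD = fundamental_treeD[OF tree]
  \<comment> \<open>The remaining darts fall into free orbits: two for each class of edges that no
    element reverses, one for each class of edges that some element reverses.\<close>
  define M where "M = darts - \<Union> (dart_orbit ` S)"
  define s where "s t = card (stabilizer G act (Inl t))" for t
  have finite_T: "finite T"
    using finite_subset[OF treeD(1) finite_graph(1)] .
  have T_verts: "t \<in> verts Y" if "t \<in> T" for t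
    using that treeD(1) by auto
  have stab: "subgroup (stabilizer G act (Inl t)) G" if "t \<in> T" for t
    using stabilizer_subgroup T_verts[OF that] by simp
  have n: "order G > 0"
    using finite_carrier order_gt_0_iff_finite by simp
  have s_pos: "s t > 0" if "t \<in> T" for t
    using subgroup.one_closed[OF stab[OF that]] finite_subset[OF subgroup.subset[OF stab[OF that]] finite_carrier]
    by (auto simp: s_def card_gt_0_iff)
  have trivial: "stabilizer G act (Inl t) \<subseteq> H"
    if t: "t \<in> T" "s t = 1" and H: "subgroup H G" for t H
  proof -
    obtain g where "stabilizer G act (Inl t) = {g}"
      using t(2) unfolding s_def by (rule card_1_singletonE)
    then show ?thesis
      using subgroup.one_closed[OF stab[OF t(1)]] subgroup.one_closed[OF H] by simp
  qed
  have M_orbit: "dart_orbit d \<subseteq> M" if "d \<in> M" for d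
  proof
    fix x assume x: "x \<in> dart_orbit d"
    have d: "d \<in> darts" using that by (simp add: M_def)
    then have "x \<in> darts" using dart_orbit_subset x by blast
    moreover have "d \<in> dart_orbit c" if "c \<in> S" "x \<in> dart_orbit c" for c
      using dart_orbit_eq[of c x] dart_orbit_eq[OF d x] self_in_dart_orbit[OF d] that treeD(3) by auto
    ultimately show "x \<in> M"
      using that by (auto simp: M_def)
  qed
  have "order G dvd card M"
    using M_orbit by (intro order_dvd_card_invariant) (auto simp: M_def)
  then obtain m where m: "card M = order G * m" ..
  have "\<Union> (dart_orbit ` S) \<subseteq> darts"
    using treeD(3) dart_orbit_subset by blast
  then have "card darts = card (\<Union> (dart_orbit ` S)) + card M"
    using card_Int_Diff[OF finite_darts, of "\<Union> (dart_orbit ` S)"] by (simp add: M_def Int_absorb1)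
  then have "card darts = card S * order G + order G * m"
    using card_tree_dart_orbits[OF tree] m by simp
  then have edges: "2 * real (card (edges Y)) = real (card S + m) * real (order G)"
    unfolding card_darts by (metis add_mult_distrib mult.commute of_nat_mult of_nat_numeral)
  have "real_of_int (int (order G)) = real_of_int (6 * (genus Y - 1))"
    using order by simp
  then have "real (order G) = 6 * real (card (edges Y)) - 6 * real (card (verts Y))"
    by (simp add: genus_def)
  \<comment> \<open>The factor 3 is half of 6, since every edge carries two darts.\<close>
  also have "\<dots> = 3 * (real (card S + m) * real (order G)) - 6 * (\<Sum>t\<in>T. real (order G) / real (s t))"
    using edges card_verts_eq_sum[OF tree spanning] by (simp add: s_def)
  also have "\<dots> = real (order G) * (3 * real (card S + m) - 6 * (\<Sum>t\<in>T. 1 / real (s t)))"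
    by (simp add: sum_distrib_left algebra_simps)
  finally have "real (order G) * (3 * real (card S + m) - 6 * (\<Sum>t\<in>T. 1 / real (s t))) = real (order G) * 1"
    by simp
  then have "3 * real (card S + m) - 6 * (\<Sum>t\<in>T. 1 / real (s t)) = 1"
    using n by (subst (asm) mult_cancel_left) auto
  \<comment> \<open>Substituting \<open>2 * card T - 2\<close> for \<open>card S\<close> moves 6 to
    the right-hand side, which turns 1 into 7.\<close>
  moreover have "real (card S) = 2 * real (card T) - 2"
    using treeD(4) by linarith
  moreover have "(\<Sum>t\<in>T. 6 * (1 - 1 / real (s t))) =
      6 * real (card T) - 6 * (\<Sum>t\<in>T. 1 / real (s t))"
    by (simp add: sum_subtractf sum_distrib_left right_diff_distrib)
  ultimately have "3 * real m + (\<Sum>t\<in>T. 6 * (1 - 1 / real (s t))) = 7"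
    by simp
  from orbifold_equation[OF finite_T s_pos this]
  consider a b where "m = 0" "{t \<in> T. s t \<noteq> 1} = {a, b}" "s a = 2" "s b = 3"
    | b where "m = 1" "{t \<in> T. s t \<noteq> 1} = {b}" "s b = 3"
    by blast
  then show ?thesis
  proof cases
    case 1
    then have ab: "a \<in> T" "b \<in> T" by blast+
    obtain x where x: "x \<in> carrier G" "ord x = 2" "generate G {x} = stabilizer G act (Inl a)"
      using subgroup_card_two_or_three_cyclic[OF finite_carrier stab[OF ab(1)]] 1(3) by (auto simp: s_def)
    obtain y where y: "y \<in> carrier G" "ord y = 3" "generate G {y} = stabilizer G act (Inl b)"
      using subgroup_card_two_or_three_cyclic[OF finite_carrier stab[OF ab(2)]] 1(4) by (auto simp: s_def)
    define H where "H = generate G {x, y}"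
    have H: "subgroup H G"
      unfolding H_def using x(1) y(1) by (intro generate_is_subgroup) simp
    have "H = carrier G"
    proof (rule generated_by_tree[OF tree H])
      fix t assume t: "t \<in> T"
      have "generate G {x} \<subseteq> H" "generate G {y} \<subseteq> H"
        unfolding H_def by (auto intro!: mono_generate del: subsetI)
      moreover have "t = a \<or> t = b \<or> s t = 1"
        using 1(2) t by blast
      ultimately show "stabilizer G act (Inl t) \<subseteq> H"
        using x(3) y(3) trivial[OF t _ H] by blast
    next
      \<comment> \<open>Since \<open>m = 0\<close>, there are no darts outside the orbits of the
        tree.\<close>
      fix u e w assume "(u, e, w) \<in> darts - \<Union> (dart_orbit ` S)"
      moreover have "finite M"
        using finite_darts by (simp add: M_def)
      ultimately show "\<exists>t \<in> T. \<exists>h \<in> H. w = vact h t"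
        using m 1(1) by (simp add: M_def[symmetric])
    qed
    then show ?thesis
      using x y H_def by blast
  next
    case 2
    then have b: "b \<in> T" by blast
    obtain y where y: "y \<in> carrier G" "ord y = 3" "generate G {y} = stabilizer G act (Inl b)"
      using subgroup_card_two_or_three_cyclic[OF finite_carrier stab[OF b]] 2(3) by (auto simp: s_def)
    have finite_M: "finite M"
      using finite_darts by (simp add: M_def)
    have card_M: "card M = order G"
      using m 2(1) by simp
    then obtain u0 e0 w0 where d0: "(u0, e0, w0) \<in> M"
      using n card_gt_0_iff[of M] by fastforce
    then have d0_darts: "(u0, e0, w0) \<in> darts"
      by (simp add: M_def)
    then obtain t g where t: "t \<in> T" and g: "g \<in> carrier G" "u0 = vact g t"
      using spanning darts_verts by blast
    \<comment> \<open>A remaining dart is translated so that it starts in the tree.\<close>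
    define e w where "e = eact (inv g) e0" and "w = vact (inv g) w0"
    have "dact (inv g) (u0, e0, w0) = (t, e, w)"
      using g T_verts[OF t] by (simp add: e_def w_def)
    moreover have "dact (inv g) (u0, e0, w0) \<in> M"
      using M_orbit[OF d0] g(1) by (auto simp: dart_orbit_def simp del: dact_simps)
    ultimately have d: "(t, e, w) \<in> M" by simp
    then have d_darts: "(t, e, w) \<in> darts"
      by (simp add: M_def)
    \<comment> \<open>With \<open>m = 1\<close> the remaining darts form a single free
      orbit.\<close>
    have M_eq: "M = dart_orbit (t, e, w)"
      using card_subset_eq[OF finite_M M_orbit[OF d]] card_dart_orbit[OF d_darts] card_M by simp
    \<comment> \<open>\<open>S\<close> is closed under reversal, hence so is \<open>M\<close>. As
      \<open>M\<close> is one orbit, some \<open>x\<close> carries the dart to its reverse.\<close>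
    have "(w, e, t) \<in> M"
    proof (rule ccontr)
      assume "(w, e, t) \<notin> M"
      moreover have "(w, e, t) \<in> darts"
        using d_darts darts_sym by blast
      ultimately obtain c where c: "c \<in> S" "(w, e, t) \<in> dart_orbit c"
        by (auto simp: M_def)
      obtain p f q where pfq: "c = (p, f, q)" by (cases c)
      obtain h where h: "h \<in> carrier G" "(w, e, t) = dact h (p, f, q)"
        using c(2) by (auto simp: dart_orbit_def pfq)
      then have "(t, e, w) \<in> dart_orbit (q, f, p)"
        by (auto simp: dart_orbit_def)
      moreover have "(q, f, p) \<in> S"
        using treeD(6) c(1) pfq by blast
      ultimately show False
        using d by (auto simp: M_def)
    qed
    then obtain x where x: "x \<in> carrier G" "vact x t = w" "eact x e = e" "vact x w = t"
      by (auto simp: M_eq dart_orbit_def)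
    \<comment> \<open>Reversing twice fixes the dart, and the action on darts is free.\<close>
    have "dact (x \<otimes> x) (t, e, w) = (t, e, w)"
      using x d_darts by (simp only: dact_mult) simp
    then have "x [^] (2::nat) = \<one>"
      using dact_free[OF _ d_darts] x(1) by (simp add: numeral_eq_Suc)
    then have "ord x dvd 2"
      using x(1) by (simp add: pow_eq_id)
    moreover have "ord x \<noteq> 1"
    proof
      assume "ord x = 1"
      then have "t = w"
        using ord_eq_1[OF x(1)] x(2) T_verts[OF t] by simp
      then show False
        using d_darts card_ends[of e] by (simp add: darts_def)
    qed
    ultimately have ord_x: "ord x = 2"
      using dvd_two_or_three by blast
    define H where "H = generate G {x, y}"
    have H: "subgroup H G"
      unfolding H_def using x(1) y(1) by (intro generate_is_subgroup) simp
    have stabilizers: "stabilizer G act (Inl t') \<subseteq> H" if t': "t' \<in> T" for t'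
    proof -
      have "generate G {y} \<subseteq> H"
        unfolding H_def by (rule mono_generate) simp
      moreover have "t' = b \<or> s t' = 1"
        using 2(2) t' by blast
      ultimately show ?thesis
        using y(3) trivial[OF t' _ H] by blast
    qed
    have "H = carrier G"
    proof (rule generated_by_tree[OF tree H stabilizers])
      fix u e' w' assume "(u, e', w') \<in> darts - \<Union> (dart_orbit ` S)" and u: "u \<in> T"
      then have "(u, e', w') \<in> dart_orbit (t, e, w)"
        by (simp only: M_eq[symmetric] M_def)
      then obtain k where k: "k \<in> carrier G" "u = vact k t" "w' = vact k w"
        by (auto simp: dart_orbit_def)
      \<comment> \<open>The only vertex of \<open>T\<close> in the orbit of \<open>t\<close> is
        \<open>t\<close> itself, so \<open>k\<close> stabilizes \<open>t\<close> and lies in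
        \<open>H\<close>; since \<open>x\<close> moves \<open>t\<close> to \<open>w\<close>, the
        vertex \<open>w'\<close> is the image of \<open>t\<close> under
        \<open>k \<otimes> x\<close>.\<close>
      have "t = u"
        by (rule treeD(5)[OF t u k(1)]) (simp add: k(2))
      then have "k \<in> H"
        using stabilizers[OF t] k(1,2) stabilizer_Inl[OF T_verts[OF t]] by auto
      moreover have "x \<in> H"
        by (simp add: H_def generate.incl)
      moreover have "w' = vact (k \<otimes> x) t"
        using k x T_verts[OF t] by (simp add: vact_mult)
      ultimately show "\<exists>t \<in> T. \<exists>h \<in> H. w' = vact h t"
        using t subgroup.m_closed[OF H] by blast
    qed
    then show ?thesis
      using x(1) ord_x y H_def by blast
  qed
qed

end

section \<open>The characterization of maximal graph groups\<close>

lemma maximal_graph_group_imp_generators: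
  assumes "maximal_graph_group G"
  shows "order G \<ge> 6" and "\<exists>x \<in> carrier G. \<exists>y \<in> carrier G.
    group.ord G x = 2 \<and> group.ord G y = 3 \<and> generate G {x, y} = carrier G"
proof -
  obtain Y :: "(nat, nat) mgraph" and act where Y: "multigraph Y" "connected_graph Y"
      "genus Y \<ge> 2" "harmonic_action G Y act" "int (order G) = 6 * (genus Y - 1)"
    and "finite (carrier G)"
    using assms by (auto simp: maximal_graph_group_def)
  interpret acting_group G Y act
    using Y by (simp add: acting_group_iff harmonic_action_def faithful_graph_action_def)
  interpret free_acting_group G Y act
    by unfold_locales (use Y(2) \<open>finite (carrier G)\<close> harmonic_action_imp_free[OF Y(4,2)] in auto)
  show "order G \<ge> 6"
    using Y(3,5) by simp
  show "\<exists>x \<in> carrier G. \<exists>y \<in> carrier G. ord x = 2 \<and> ord y = 3 \<and> generate G {x, y} = carrier G"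
    by (rule exists_generators[OF Y(5)])
qed

theorem theorem1p1:
  fixes G :: "('a, 'm) monoid_scheme"
  assumes "group G" and "finite (carrier G)"
  shows "(maximal_graph_group G \<longleftrightarrow> order G \<ge> 6 \<and> is_quotient_of G modular_group) \<and>
    (order G \<ge> 6 \<and> is_quotient_of G modular_group \<longleftrightarrow>
      order G \<ge> 6 \<and>
      (\<exists>x \<in> carrier G. \<exists>y \<in> carrier G.
         group.ord G x = 2 \<and> group.ord G y = 3 \<and> generate G {x, y} = carrier G))"
proof -
  interpret group G by fact
  let ?gens = "\<exists>x \<in> carrier G. \<exists>y \<in> carrier G.
    ord x = 2 \<and> ord y = 3 \<and> generate G {x, y} = carrier G"
  have "maximal_graph_group G \<longleftrightarrow> order G \<ge> 6 \<and> ?gens"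
    using maximal_graph_group_imp_generators maximal_graph_group_if_ord[OF assms(2)] by blast
  then show ?thesis
    using is_quotient_of_modular_group_iff_ord by blast
qed

end
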